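(* Suppose $q=q_n \le b\sqrt{n}$ for a constant $b<1/2$ not depending on $n$. Then there exist a constant $C=C(b)>0$ and a polynomial $f=f_n:\mathbb{R}^{\binom n2}\to\mathbb{R}$ of degree at most $C\log n$ that strongly separates $G(n,1/2)$ and $\mathcal{R}_q$.
   Context: Graphs on $[n]$ are encoded as $X\in\{\pm1\}^{\binom n2}$ ($+1$ = edge present, $-1$ = absent). $G(n,1/2)$ is the Erdős–Rényi random graph, i.e., uniform on $\{\pm1\}^{\binom n2}$. $\mathcal{R}_q\subseteq\{\pm1\}^{\binom n2}$ is the set of $q$-colorable graphs. A polynomial $f$ strongly separates a distribution $\mathbb{Q}$ and a set $\mathcal{R}$ if $f(X)\ge 1$ for all $X\in\mathcal{R}$ and $\mathbb{E}_{\mathbb{Q}}[f^2]=o(1)$ as $n\to\infty$. *)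

theory Defs
  imports "HOL-Probability.Probability" "HOL-Library.Poly_Mapping"
    "HOL-Library.Landau_Symbols"
begin

text \<open>
  Multivariate real polynomials in variables indexed by \<open>'v\<close>: a finitely supported map from
  monomials (finitely supported exponent vectors) to coefficients.
\<close>

type_synonym 'v mpoly = "('v \<Rightarrow>\<^sub>0 nat) \<Rightarrow>\<^sub>0 real"

definition poly_eval :: "'v mpoly \<Rightarrow> ('v \<Rightarrow> real) \<Rightarrow> real" where
  "poly_eval p x = (\<Sum>m\<in>Poly_Mapping.keys p. Poly_Mapping.lookup p m *
     (\<Prod>v\<in>Poly_Mapping.keys m. x v ^ Poly_Mapping.lookup m v))"

definition poly_vars :: "'v mpoly \<Rightarrow> 'v set" where
  "poly_vars p = (\<Union>m\<in>Poly_Mapping.keys p. Poly_Mapping.keys m)"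

definition monom_degree :: "('v \<Rightarrow>\<^sub>0 nat) \<Rightarrow> nat" where
  "monom_degree m = (\<Sum>v\<in>Poly_Mapping.keys m. Poly_Mapping.lookup m v)"

text \<open>Total degree; the zero polynomial gets degree \<open>0\<close>.\<close>

definition total_degree :: "'v mpoly \<Rightarrow> nat" where
  "total_degree p = Max (insert 0 (monom_degree ` Poly_Mapping.keys p))"

definition potential_edges :: "nat \<Rightarrow> nat set set" where
  "potential_edges n = {e. e \<subseteq> {1..n} \<and> card e = 2}"

text \<open>
  A graph on \<open>{1..n}\<close> is a sign vector indexed by the potential edges (\<open>1\<close> for present,
  \<open>-1\<close> for absent), extended by \<open>undefined\<close> so that distinct elements are distinct graphs.
\<close>

definition graphs :: "nat \<Rightarrow> (nat set \<Rightarrow> real) set" where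
  "graphs n = potential_edges n \<rightarrow>\<^sub>E {-1, 1}"

definition erdos_renyi_half :: "nat \<Rightarrow> (nat set \<Rightarrow> real) pmf" where
  "erdos_renyi_half n = pmf_of_set (graphs n)"

definition colorable_graphs :: "nat \<Rightarrow> nat \<Rightarrow> (nat set \<Rightarrow> real) set" where
  "colorable_graphs q n = {X \<in> graphs n. \<exists>c \<in> {1..n} \<rightarrow> {1..q}.
     \<forall>u\<in>{1..n}. \<forall>v\<in>{1..n}. u \<noteq> v \<longrightarrow> X {u, v} = 1 \<longrightarrow> c u \<noteq> c v}"

definition strongly_separates ::
  "(nat \<Rightarrow> 'v mpoly) \<Rightarrow> (nat \<Rightarrow> ('v \<Rightarrow> real) pmf) \<Rightarrow> (nat \<Rightarrow> ('v \<Rightarrow> real) set) \<Rightarrow> bool" where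
  "strongly_separates f Q R \<longleftrightarrow>
     (\<forall>n. \<forall>X\<in>R n. poly_eval (f n) X \<ge> 1) \<and>
     (\<lambda>n. measure_pmf.expectation (Q n) (\<lambda>X. (poly_eval (f n) X)\<^sup>2)) \<in> o(\<lambda>_. 1)"

end

theory Submission
  imports Defs "HOL-Real_Asymp.Real_Asymp"
begin

text \<open>
  Let \<open>A\<close> be the symmetric sign matrix of the graph, with zero diagonal. The separating polynomial
  is \<open>tr (A ^ N) / (\<gamma> * sqrt n) ^ N\<close> with \<open>2 < \<gamma> < 1/b\<close>, where \<open>N\<close> is a power of two of order
  \<open>ln n\<close>.

  A \<open>q\<close>-colorable graph has an independent set \<open>S\<close> with \<open>card S \<ge> n/q\<close>. Its indicator has Rayleigh
  quotient \<open>1 - card S\<close>, and repeated use of the Cauchy-Schwarz inequality gives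
  \<open>tr (A ^ N) \<ge> (card S - 1) ^ N\<close>.

  For the second moment, a sign variable \<open>X e\<close> satisfies \<open>E (X e * F) \<le> E (\<partial>F/\<partial>X e)\<close> for every polynomial
  \<open>F\<close> with nonnegative coefficients (for Gaussian variables this would be integration by parts,
  with equality). Applied to products of traces it yields loop inequalities for the moments
  \<open>E (tr (A ^ a\<^sub>1) * \<dots> * tr (A ^ a\<^sub>k))\<close>. These are compared with a Catalan-type
  recursion that has been perturbed by \<open>\<delta> * \<beta> ^ a\<close>; this term absorbs every contribution of lower
  order in \<open>n\<close> as long as the total degree is small compared with a power of \<open>n\<close>, and
  the solution grows only like \<open>\<beta> ^ a\<close>, where \<open>2 < \<beta> < \<gamma>\<close>.
\<close>

subsection \<open>Random signs and polynomials with nonnegative coefficients\<close>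

definition expct :: "nat \<Rightarrow> ((nat set \<Rightarrow> real) \<Rightarrow> real) \<Rightarrow> real" where
  "expct n F = measure_pmf.expectation (erdos_renyi_half n) F"

lemma finite_potential_edges: "finite (potential_edges n)"
  unfolding potential_edges_def by (rule finite_subset[of _ "Pow {1..n}"]) auto

lemma finite_graphs: "finite (graphs n)"
  unfolding graphs_def by (intro finite_PiE finite_potential_edges) auto

lemma graphs_nonempty: "graphs n \<noteq> {}"
  unfolding graphs_def by (auto simp: PiE_eq_empty_iff)

lemma expct_eq: "expct n F = (\<Sum>X\<in>graphs n. F X) / card (graphs n)"
  unfolding expct_def erdos_renyi_half_def
  by (rule integral_pmf_of_set[OF graphs_nonempty finite_graphs])

lemma expct_add: "expct n (\<lambda>X. F X + G X) = expct n F + expct n G"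
  by (simp add: expct_eq sum.distrib add_divide_distrib)

lemma expct_cmult: "expct n (\<lambda>X. c * F X) = c * expct n F"
  by (simp add: expct_eq sum_distrib_left)

lemma expct_const [simp]: "expct n (\<lambda>X. c) = c"
  using graphs_nonempty[of n] finite_graphs[of n] by (simp add: expct_eq)

lemma expct_sum: "expct n (\<lambda>X. \<Sum>i\<in>I. F i X) = (\<Sum>i\<in>I. expct n (F i))"
  by (induction I rule: infinite_finite_induct) (simp_all add: expct_add)

lemma expct_sum_mset: "expct n (\<lambda>X. \<Sum>i\<in>#A. F i X) = (\<Sum>i\<in>#A. expct n (F i))"
  by (induction A) (simp_all add: expct_add)

lemma expct_sum_list: "expct n (\<lambda>X. \<Sum>i\<leftarrow>xs. F i X) = (\<Sum>i\<leftarrow>xs. expct n (F i))"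
  by (induction xs) (simp_all add: expct_add)

lemma expct_cong: "(\<And>X. X \<in> graphs n \<Longrightarrow> F X = G X) \<Longrightarrow> expct n F = expct n G"
  by (simp add: expct_eq)

lemma graphs_sq: "X \<in> graphs n \<Longrightarrow> e \<in> potential_edges n \<Longrightarrow> X e * X e = 1"
  unfolding graphs_def by (auto simp: PiE_iff)

text \<open>Words in the edges. Repetitions are kept although \<open>X e * X e = 1\<close> on
  graphs, because the formal derivative below depends on the word and not only on the function it
  induces on \<open>graphs n\<close>.\<close>

definition mon :: "nat set list \<Rightarrow> (nat set \<Rightarrow> real) \<Rightarrow> real" where
  "mon m X = (\<Prod>e\<leftarrow>m. X e)"

lemma mon_simps [simp]: "mon [] X = 1" "mon (e # m) X = X e * mon m X"
  "mon (l @ m) X = mon l X * mon m X"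
  by (simp_all add: mon_def)

lemma mon_fun_upd: "e \<notin> set m \<Longrightarrow> mon m (X(e := c)) = mon m X"
  by (induction m) auto

lemma mon_remove1: "e \<in> set m \<Longrightarrow> mon m X = X e * mon (remove1 e m) X"
  by (induction m) auto

text \<open>Flipping the sign of \<open>X e\<close> is an involution of \<open>graphs n\<close> that
  negates the integrand.\<close>

lemma expct_mon_odd:
  assumes e: "e \<in> potential_edges n" and "e \<notin> set m"
  shows "expct n (\<lambda>X. X e * mon m X) = 0"
proof -
  let ?F = "\<lambda>X. X e * mon m X" and ?flip = "\<lambda>X. X(e := - X e)"
  have "bij_betw ?flip (graphs n) (graphs n)"
  proof (rule bij_betw_byWitness[where f' = ?flip])
    have "?flip X \<in> graphs n" if "X \<in> graphs n" for X
    proof -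
      have "X e \<in> {-1, 1}" using that e unfolding graphs_def by blast
      then show ?thesis using that e unfolding graphs_def by (auto simp: PiE_iff extensional_def)
    qed
    then show "?flip ` graphs n \<subseteq> graphs n" "?flip ` graphs n \<subseteq> graphs n" by auto
  qed simp_all
  then have "(\<Sum>X\<in>graphs n. ?F (?flip X)) = (\<Sum>X\<in>graphs n. ?F X)"
    by (rule sum.reindex_bij_betw)
  moreover have "?F (?flip X) = - ?F X" for X
    using assms(2) by (simp add: mon_fun_upd)
  ultimately have "(\<Sum>X\<in>graphs n. ?F X) = 0"
    by (simp only: sum_negf)
  then show ?thesis
    by (simp add: expct_eq)
qed

text \<open>Either the first letter occurs again and the pair cancels, since
  \<open>X e * X e = 1\<close>, or it occurs only once and the expectation vanishes.\<close>

lemma expct_mon_nonneg: "set m \<subseteq> potential_edges n \<Longrightarrow> expct n (mon m) \<ge> 0"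
proof (induction m rule: length_induct)
  case (1 m)
  show ?case
  proof (cases m)
    case Nil
    then show ?thesis by (simp add: expct_eq sum_nonneg)
  next
    case (Cons e l)
    then have e: "e \<in> potential_edges n" using 1 by auto
    show ?thesis
    proof (cases "e \<in> set l")
      case True
      have "expct n (mon m) = expct n (mon (remove1 e l))"
      proof (rule expct_cong)
        fix X assume "X \<in> graphs n"
        then show "mon m X = mon (remove1 e l) X"
          using graphs_sq[OF _ e] mon_remove1[OF True, of X] Cons by (simp flip: mult.assoc)
      qed
      also have "\<dots> \<ge> 0"
      proof -
        have "length (remove1 e l) < length m"
          using Cons by (simp add: length_remove1 less_Suc_eq_le)
        moreover have "set (remove1 e l) \<subseteq> potential_edges n"
          using 1(2) Cons set_remove1_subset[of e l] by auto
        ultimately show ?thesis using 1(1) by blast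
      qed
      finally show ?thesis .
    next
      case False
      then show ?thesis using expct_mon_odd[OF e False] Cons by (simp add: mon_def[abs_def])
    qed
  qed
qed

fun dmon :: "nat set \<Rightarrow> nat set list \<Rightarrow> (nat set \<Rightarrow> real) \<Rightarrow> real" where
  "dmon e [] X = 0"
| "dmon e (a # m) X = of_bool (a = e) * mon m X + X a * dmon e m X"

lemma dmon_append: "dmon e (l @ m) X = dmon e l X * mon m X + mon l X * dmon e m X"
  by (induction l) (auto simp: algebra_simps)

text \<open>The derivative of a word is a sum of words, one per occurrence of \<open>e\<close>, so
  \<open>expct_mon_nonneg\<close> applies to each; \<open>l\<close> collects the letters already
  passed.\<close>

lemma expct_mon_dmon_nonneg:
  "set l \<subseteq> potential_edges n \<Longrightarrow> set m \<subseteq> potential_edges n \<Longrightarrow> expct n (\<lambda>X. mon l X * dmon e m X) \<ge> 0"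
proof (induction m arbitrary: l)
  case (Cons a m)
  have "expct n (\<lambda>X. mon l X * dmon e (a # m) X) =
    of_bool (a = e) * expct n (mon (l @ m)) + expct n (\<lambda>X. mon (l @ [a]) X * dmon e m X)"
    by (simp add: expct_add[symmetric] expct_cmult[symmetric] algebra_simps)
  also have "\<dots> \<ge> 0"
    using Cons.prems by (intro add_nonneg_nonneg mult_nonneg_nonneg Cons.IH expct_mon_nonneg) auto
  finally show ?case .
qed simp

text \<open>The factor \<open>mon l\<close>, in which \<open>e\<close> does not occur, is needed only for the induction on \<open>m\<close>.\<close>

lemma expct_edge_mon_le:
  assumes e: "e \<in> potential_edges n"
  shows "set l \<subseteq> potential_edges n \<Longrightarrow> set m \<subseteq> potential_edges n \<Longrightarrow> e \<notin> set l \<Longrightarrow>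
    expct n (\<lambda>X. X e * mon l X * mon m X) \<le> expct n (\<lambda>X. mon l X * dmon e m X)"
proof (induction m arbitrary: l)
  case Nil
  then show ?case using expct_mon_odd[OF e, of l] by simp
next
  case (Cons a m)
  show ?case
  proof (cases "a = e")
    case True
    \<comment> \<open>Here \<open>X e * X e = 1\<close> reproduces exactly the derivative of the
      first occurrence of \<open>e\<close>; further occurrences only add nonnegative terms.\<close>
    have "expct n (\<lambda>X. X e * mon l X * mon (a # m) X) = expct n (mon (l @ m))"
    proof (rule expct_cong)
      fix X assume "X \<in> graphs n"
      have "X e * mon l X * mon (a # m) X = (X e * X e) * mon (l @ m) X"
        using True by (simp add: mult_ac)
      then show "X e * mon l X * mon (a # m) X = mon (l @ m) X"
        using graphs_sq[OF \<open>X \<in> graphs n\<close> e] by simp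
    qed
    also have "\<dots> \<le> expct n (mon (l @ m)) + expct n (\<lambda>X. mon (l @ [a]) X * dmon e m X)"
      using Cons.prems by (simp del: mon_simps) (intro expct_mon_dmon_nonneg, auto)
    also have "\<dots> = expct n (\<lambda>X. mon l X * dmon e (a # m) X)"
      using True by (simp add: expct_add[symmetric] algebra_simps)
    finally show ?thesis .
  next
    case False
    then show ?thesis using Cons.IH[of "a # l"] Cons.prems by (simp add: algebra_simps)
  qed
qed

text \<open>
  \<open>F\<close> is a sum of monomials of degree at most \<open>d\<close>, each with coefficient \<open>1\<close> but possibly repeated,
  and \<open>D e\<close> is its formal partial derivative in direction \<open>e\<close>.
\<close>

definition nonneg_poly ::
  "nat \<Rightarrow> nat \<Rightarrow> ((nat set \<Rightarrow> real) \<Rightarrow> real) \<Rightarrow> (nat set \<Rightarrow> (nat set \<Rightarrow> real) \<Rightarrow> real) \<Rightarrow> bool" where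
  "nonneg_poly n d F D \<longleftrightarrow> (\<exists>ms. (\<forall>m\<in>set ms. set m \<subseteq> potential_edges n \<and> length m \<le> d) \<and>
     (\<forall>X. F X = (\<Sum>m\<leftarrow>ms. mon m X)) \<and> (\<forall>e X. D e X = (\<Sum>m\<leftarrow>ms. dmon e m X)))"

lemma nonneg_polyE:
  assumes "nonneg_poly n d F D"
  obtains ms where "\<And>m. m \<in> set ms \<Longrightarrow> set m \<subseteq> potential_edges n"
    "\<And>m. m \<in> set ms \<Longrightarrow> length m \<le> d"
    "F = (\<lambda>X. \<Sum>m\<leftarrow>ms. mon m X)" "D = (\<lambda>e X. \<Sum>m\<leftarrow>ms. dmon e m X)"
  using assms unfolding nonneg_poly_def fun_eq_iff by blast

lemma nonneg_polyI:
  assumes "\<And>m. m \<in> set ms \<Longrightarrow> set m \<subseteq> potential_edges n" "\<And>m. m \<in> set ms \<Longrightarrow> length m \<le> d"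
    "\<And>X. F X = (\<Sum>m\<leftarrow>ms. mon m X)" "\<And>e X. D e X = (\<Sum>m\<leftarrow>ms. dmon e m X)"
  shows "nonneg_poly n d F D"
  using assms unfolding nonneg_poly_def by blast

lemma nonneg_poly_zero: "nonneg_poly n d (\<lambda>_. 0) (\<lambda>_ _. 0)"
  by (rule nonneg_polyI[of "[]"]) simp_all

lemma nonneg_poly_one: "nonneg_poly n d (\<lambda>_. 1) (\<lambda>_ _. 0)"
  by (rule nonneg_polyI[of "[[]]"]) simp_all

lemma nonneg_poly_edge:
  "a \<in> potential_edges n \<Longrightarrow> nonneg_poly n 1 (\<lambda>X. X a) (\<lambda>e _. of_bool (a = e))"
  by (rule nonneg_polyI[of "[[a]]"]) simp_all

lemma nonneg_poly_add:
  assumes "nonneg_poly n d F D" "nonneg_poly n d G D'"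
  shows "nonneg_poly n d (\<lambda>X. F X + G X) (\<lambda>e X. D e X + D' e X)"
proof -
  obtain ms where ms: "\<And>m. m \<in> set ms \<Longrightarrow> set m \<subseteq> potential_edges n"
    "\<And>m. m \<in> set ms \<Longrightarrow> length m \<le> d"
    "F = (\<lambda>X. \<Sum>m\<leftarrow>ms. mon m X)" "D = (\<lambda>e X. \<Sum>m\<leftarrow>ms. dmon e m X)"
    using assms(1) by (rule nonneg_polyE) blast
  obtain ms' where ms': "\<And>m. m \<in> set ms' \<Longrightarrow> set m \<subseteq> potential_edges n"
    "\<And>m. m \<in> set ms' \<Longrightarrow> length m \<le> d"
    "G = (\<lambda>X. \<Sum>m\<leftarrow>ms'. mon m X)" "D' = (\<lambda>e X. \<Sum>m\<leftarrow>ms'. dmon e m X)"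
    using assms(2) by (rule nonneg_polyE) blast
  show ?thesis
    by (rule nonneg_polyI[of "ms @ ms'"]) (use ms(1,2) ms'(1,2) in \<open>auto simp: ms(3,4) ms'(3,4)\<close>)
qed

lemma nonneg_poly_sum:
  "(\<And>i. i \<in> I \<Longrightarrow> nonneg_poly n d (F i) (D i)) \<Longrightarrow>
    nonneg_poly n d (\<lambda>X. \<Sum>i\<in>I. F i X) (\<lambda>e X. \<Sum>i\<in>I. D i e X)"
  by (induction I rule: infinite_finite_induct) (simp_all add: nonneg_poly_zero nonneg_poly_add)

lemma nonneg_poly_mult:
  assumes "nonneg_poly n d F D" "nonneg_poly n d' G D'"
  shows "nonneg_poly n (d + d') (\<lambda>X. F X * G X) (\<lambda>e X. D e X * G X + F X * D' e X)"
proof -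
  obtain ms where ms: "\<And>m. m \<in> set ms \<Longrightarrow> set m \<subseteq> potential_edges n"
    "\<And>m. m \<in> set ms \<Longrightarrow> length m \<le> d"
    and F: "F = (\<lambda>X. \<Sum>m\<leftarrow>ms. mon m X)" and D: "D = (\<lambda>e X. \<Sum>m\<leftarrow>ms. dmon e m X)"
    using assms(1) by (rule nonneg_polyE) blast
  obtain ms' where ms': "\<And>m. m \<in> set ms' \<Longrightarrow> set m \<subseteq> potential_edges n"
    "\<And>m. m \<in> set ms' \<Longrightarrow> length m \<le> d'"
    and G: "G = (\<lambda>X. \<Sum>m\<leftarrow>ms'. mon m X)" and D': "D' = (\<lambda>e X. \<Sum>m\<leftarrow>ms'. dmon e m X)"
    using assms(2) by (rule nonneg_polyE) blast
  let ?ps = "concat (map (\<lambda>m. map (\<lambda>m'. m @ m') ms') ms)"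
  show ?thesis
  proof (rule nonneg_polyI[of ?ps])
    fix m assume "m \<in> set ?ps"
    then obtain l l' where "m = l @ l'" "l \<in> set ms" "l' \<in> set ms'" by auto
    with ms ms' show "set m \<subseteq> potential_edges n" "length m \<le> d + d'"
      by (simp_all add: add_mono)
  next
    fix X
    show "F X * G X = (\<Sum>m\<leftarrow>?ps. mon m X)"
      unfolding F G by (induction ms) (simp_all add: distrib_right sum_list_const_mult o_def)
  next
    fix e X
    show "D e X * G X + F X * D' e X = (\<Sum>m\<leftarrow>?ps. dmon e m X)"
      unfolding F G D D'
    proof (induction ms)
      case (Cons l ms)
      have "(\<Sum>m\<leftarrow>ms'. dmon e (l @ m) X) =
          dmon e l X * (\<Sum>m\<leftarrow>ms'. mon m X) + mon l X * (\<Sum>m\<leftarrow>ms'. dmon e m X)"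
        by (simp add: dmon_append sum_list_addf sum_list_const_mult)
      with Cons show ?case by (simp add: o_def distrib_left distrib_right)
    qed simp
  qed
qed

lemma nonneg_poly_expct_nonneg:
  assumes "nonneg_poly n d F D"
  shows "expct n F \<ge> 0"
  using assms
proof (rule nonneg_polyE)
  fix ms assume ms: "\<And>m. m \<in> set ms \<Longrightarrow> set m \<subseteq> potential_edges n"
    and F: "F = (\<lambda>X. \<Sum>m\<leftarrow>ms. mon m X)"
  have "expct n F = (\<Sum>m\<leftarrow>ms. expct n (mon m))"
    unfolding F by (rule expct_sum_list)
  also have "\<dots> \<ge> 0"
    using ms by (intro sum_list_nonneg) (auto intro!: expct_mon_nonneg)
  finally show ?thesis .
qed

text \<open>Linear extension of \<open>expct_edge_mon_le\<close>. On a word with an odd number k of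
  copies of \<open>e\<close>, the left side counts the remaining word once and the derivative counts
  it k times; for even k both sides vanish.\<close>

lemma expct_edge_mult_le:
  assumes "nonneg_poly n d F D" and e: "e \<in> potential_edges n"
  shows "expct n (\<lambda>X. X e * F X) \<le> expct n (D e)"
  using assms(1)
proof (rule nonneg_polyE)
  fix ms assume ms: "\<And>m. m \<in> set ms \<Longrightarrow> set m \<subseteq> potential_edges n"
    and F: "F = (\<lambda>X. \<Sum>m\<leftarrow>ms. mon m X)" and D: "D = (\<lambda>e X. \<Sum>m\<leftarrow>ms. dmon e m X)"
  have "expct n (\<lambda>X. X e * F X) = (\<Sum>m\<leftarrow>ms. expct n (\<lambda>X. X e * mon m X))"
    unfolding F by (simp only: sum_list_const_mult[symmetric] expct_sum_list)
  also have "\<dots> \<le> (\<Sum>m\<leftarrow>ms. expct n (dmon e m))"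
    using ms expct_edge_mon_le[OF e, of "[]"] by (intro sum_list_mono) simp
  also have "\<dots> = expct n (D e)"
    unfolding D by (rule expct_sum_list[symmetric])
  finally show ?thesis .
qed

subsection \<open>Traces of powers and loop inequalities\<close>

definition entry :: "nat \<Rightarrow> nat \<Rightarrow> (nat set \<Rightarrow> real) \<Rightarrow> real" where
  "entry x y X = (if x = y then 0 else X {x, y})"

fun mpow :: "nat \<Rightarrow> nat \<Rightarrow> nat \<Rightarrow> nat \<Rightarrow> (nat set \<Rightarrow> real) \<Rightarrow> real" where
  "mpow n 0 x y X = of_bool (x = y)"
| "mpow n (Suc a) x y X = (\<Sum>z\<in>{1..n}. entry x z X * mpow n a z y X)"

fun dmpow :: "nat \<Rightarrow> nat \<Rightarrow> nat \<Rightarrow> nat \<Rightarrow> nat set \<Rightarrow> (nat set \<Rightarrow> real) \<Rightarrow> real" where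
  "dmpow n 0 x y e X = 0"
| "dmpow n (Suc a) x y e X = (\<Sum>z\<in>{1..n}.
     of_bool (x \<noteq> z \<and> {x, z} = e) * mpow n a z y X + entry x z X * dmpow n a z y e X)"

lemma edge_in_potential_edges:
  "x \<in> {1..n} \<Longrightarrow> y \<in> {1..n} \<Longrightarrow> x \<noteq> y \<Longrightarrow> {x, y} \<in> potential_edges n"
  by (simp add: potential_edges_def)

lemma entry_sym: "entry x y X = entry y x X"
  by (simp add: entry_def insert_commute)

lemma nonneg_poly_entry:
  assumes "x \<in> {1..n}" "y \<in> {1..n}"
  shows "nonneg_poly n 1 (entry x y) (\<lambda>e X. of_bool (x \<noteq> y \<and> {x, y} = e))"
proof (cases "x = y")
  case True
  then show ?thesis using nonneg_poly_zero[of n 1] by (simp add: entry_def[abs_def])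
next
  case False
  then show ?thesis
    using nonneg_poly_edge[OF edge_in_potential_edges[OF assms]] by (simp add: entry_def[abs_def])
qed

lemma nonneg_poly_mpow:
  "x \<in> {1..n} \<Longrightarrow> nonneg_poly n a (mpow n a x y) (dmpow n a x y)"
proof (induction a arbitrary: x)
  case 0
  have "mpow n 0 x y = (\<lambda>X. of_bool (x = y))" "dmpow n 0 x y = (\<lambda>e X. 0)"
    by (simp_all add: fun_eq_iff)
  then show ?case
    using nonneg_poly_zero[of n 0] nonneg_poly_one[of n 0] by (cases "x = y") simp_all
next
  case (Suc a)
  have "nonneg_poly n (1 + a) (\<lambda>X. \<Sum>z\<in>{1..n}. entry x z X * mpow n a z y X)
    (\<lambda>e X. \<Sum>z\<in>{1..n}. of_bool (x \<noteq> z \<and> {x, z} = e) * mpow n a z y X + entry x z X * dmpow n a z y e X)"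
    by (intro nonneg_poly_sum nonneg_poly_mult nonneg_poly_entry Suc.IH Suc.prems) simp_all
  moreover have "mpow n (Suc a) x y = (\<lambda>X. \<Sum>z\<in>{1..n}. entry x z X * mpow n a z y X)"
    "dmpow n (Suc a) x y = (\<lambda>e X. \<Sum>z\<in>{1..n}.
      of_bool (x \<noteq> z \<and> {x, z} = e) * mpow n a z y X + entry x z X * dmpow n a z y e X)"
    by (simp_all add: fun_eq_iff)
  ultimately show ?case by simp
qed

lemma mpow_one: "y \<in> {1..n} \<Longrightarrow> mpow n 1 x y X = entry x y X"
  by (simp add: of_bool_def if_distrib sum.delta cong: if_cong)

lemma mpow_add:
  "x \<in> {1..n} \<Longrightarrow> mpow n (a + b) x y X = (\<Sum>z\<in>{1..n}. mpow n a x z X * mpow n b z y X)"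
proof (induction a arbitrary: x)
  case 0
  then show ?case by (simp add: of_bool_def if_distrib[of "\<lambda>t. t * _"] sum.delta' cong: if_cong)
next
  case (Suc a)
  have "mpow n (Suc a + b) x y X =
    (\<Sum>w\<in>{1..n}. \<Sum>z\<in>{1..n}. entry x w X * mpow n a w z X * mpow n b z y X)"
    using Suc.IH by (simp add: sum_distrib_left mult.assoc)
  also have "\<dots> = (\<Sum>z\<in>{1..n}. \<Sum>w\<in>{1..n}. entry x w X * mpow n a w z X * mpow n b z y X)"
    by (rule sum.swap)
  also have "\<dots> = (\<Sum>z\<in>{1..n}. mpow n (Suc a) x z X * mpow n b z y X)"
    by (simp add: sum_distrib_right)
  finally show ?case .
qed

lemma mpow_sym: "x \<in> {1..n} \<Longrightarrow> y \<in> {1..n} \<Longrightarrow> mpow n a x y X = mpow n a y x X"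
proof (induction a arbitrary: x y)
  case (Suc a)
  have "mpow n (Suc a) x y X = (\<Sum>z\<in>{1..n}. mpow n a y z X * mpow n 1 z x X)"
    unfolding mpow.simps
  proof (rule sum.cong)
    fix z assume "z \<in> {1..n}"
    then show "entry x z X * mpow n a z y X = mpow n a y z X * mpow n 1 z x X"
      using Suc by (simp only: mpow_one entry_sym[of x z] mult.commute)
  qed simp
  also have "\<dots> = mpow n (a + 1) y x X"
    using Suc.prems by (intro mpow_add[symmetric])
  finally show ?case by simp
qed auto

text \<open>Differentiating A^a removes the factor at some position j and leaves A^j and A^(a - 1 -
  j) around it. The edge \<open>{u, v}\<close> occupies the entries (u, v) and (v, u) of A, hence
  two terms.\<close>

lemma dmpow_edge:
  assumes "u \<in> {1..n}" "v \<in> {1..n}" "u \<noteq> v"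
  shows "dmpow n a x y {u, v} X = (\<Sum>j<a. mpow n j x u X * mpow n (a - 1 - j) v y X +
    mpow n j x v X * mpow n (a - 1 - j) u y X)"
proof (induction a arbitrary: x)
  case (Suc a)
  let ?m = "\<lambda>z. mpow n a z y X"
  have "of_bool (x \<noteq> z \<and> {x, z} = {u, v}) * ?m z =
    of_bool (x = u) * (if z = v then ?m z else 0) + of_bool (x = v) * (if z = u then ?m z else 0)" for z
    using assms(3) by (auto simp: doubleton_eq_iff)
  then have 1: "(\<Sum>z\<in>{1..n}. of_bool (x \<noteq> z \<and> {x, z} = {u, v}) * ?m z) =
    mpow n 0 x u X * ?m v + mpow n 0 x v X * ?m u"
    using assms(1,2) by (simp add: sum.distrib sum.delta flip: sum_distrib_left)
  have "(\<Sum>z\<in>{1..n}. entry x z X * dmpow n a z y {u, v} X) =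
    (\<Sum>z\<in>{1..n}. \<Sum>j<a. entry x z X * mpow n j z u X * mpow n (a - 1 - j) v y X +
      entry x z X * mpow n j z v X * mpow n (a - 1 - j) u y X)"
    unfolding Suc.IH by (simp add: sum_distrib_left algebra_simps)
  also have "\<dots> = (\<Sum>j<a. \<Sum>z\<in>{1..n}. entry x z X * mpow n j z u X * mpow n (a - 1 - j) v y X +
      entry x z X * mpow n j z v X * mpow n (a - 1 - j) u y X)"
    by (rule sum.swap)
  also have "\<dots> = (\<Sum>j<a. mpow n (Suc j) x u X * mpow n (Suc a - 1 - Suc j) v y X +
    mpow n (Suc j) x v X * mpow n (Suc a - 1 - Suc j) u y X)"
    by (intro sum.cong refl) (simp add: sum.distrib sum_distrib_right)
  finally have 2: "(\<Sum>z\<in>{1..n}. entry x z X * dmpow n a z y {u, v} X) =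
    (\<Sum>j<a. mpow n (Suc j) x u X * mpow n (Suc a - 1 - Suc j) v y X +
    mpow n (Suc j) x v X * mpow n (Suc a - 1 - Suc j) u y X)" .
  have "dmpow n (Suc a) x y {u, v} X = (\<Sum>z\<in>{1..n}. of_bool (x \<noteq> z \<and> {x, z} = {u, v}) * ?m z) +
    (\<Sum>z\<in>{1..n}. entry x z X * dmpow n a z y {u, v} X)"
    by (simp only: dmpow.simps sum.distrib)
  then show ?case
    unfolding 1 2 sum.lessThan_Suc_shift by simp
qed simp

section \<open>Traces, products of traces and their derivatives\<close>

definition tr :: "nat \<Rightarrow> nat \<Rightarrow> (nat set \<Rightarrow> real) \<Rightarrow> real" where
  "tr n a X = (\<Sum>x\<in>{1..n}. mpow n a x x X)"

definition dtr :: "nat \<Rightarrow> nat \<Rightarrow> nat set \<Rightarrow> (nat set \<Rightarrow> real) \<Rightarrow> real" where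
  "dtr n a e X = (\<Sum>x\<in>{1..n}. dmpow n a x x e X)"

lemma nonneg_poly_tr: "nonneg_poly n a (tr n a) (dtr n a)"
  unfolding tr_def[abs_def] dtr_def[abs_def] by (intro nonneg_poly_sum nonneg_poly_mpow)

lemma tr_zero [simp]: "tr n 0 X = n"
  by (simp add: tr_def)

lemma tr_add: "tr n (a + b) X = (\<Sum>x\<in>{1..n}. \<Sum>y\<in>{1..n}. mpow n a x y X * mpow n b y x X)"
  unfolding tr_def by (intro sum.cong refl mpow_add)

lemma tr_add': "tr n (a + b) X = (\<Sum>x\<in>{1..n}. \<Sum>y\<in>{1..n}. mpow n a x y X * mpow n b x y X)"
  unfolding tr_add by (intro sum.cong refl arg_cong2[where f="(*)"] mpow_sym)

text \<open>By cyclicity of the trace and symmetry of A, each of the b positions and both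
  orientations of the edge give the same entry of A^(b - 1). For b = 0 the factor b hides the
  truncated subtraction.\<close>

lemma dtr_edge:
  assumes uv: "u \<in> {1..n}" "v \<in> {1..n}" "u \<noteq> v"
  shows "dtr n b {u, v} X = 2 * b * mpow n (b - 1) u v X"
proof -
  have *: "(\<Sum>x\<in>{1..n}. mpow n j x p X * mpow n (b - 1 - j) r x X) = mpow n (b - 1) u v X"
    if "j < b" and pr: "(p, r) = (u, v) \<or> (p, r) = (v, u)" for j p r
  proof -
    have "(\<Sum>x\<in>{1..n}. mpow n j x p X * mpow n (b - 1 - j) r x X) =
        (\<Sum>x\<in>{1..n}. mpow n (b - 1 - j) r x X * mpow n j x p X)"
      by (simp add: mult.commute)
    also have "\<dots> = mpow n ((b - 1 - j) + j) r p X"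
      using uv pr by (intro mpow_add[symmetric]) auto
    also have "\<dots> = mpow n (b - 1) u v X"
      using uv pr \<open>j < b\<close> mpow_sym[of u n v] by auto
    finally show ?thesis .
  qed
  have "dtr n b {u, v} X = (\<Sum>j<b. \<Sum>x\<in>{1..n}. mpow n j x u X * mpow n (b - 1 - j) v x X +
    mpow n j x v X * mpow n (b - 1 - j) u x X)"
    unfolding dtr_def dmpow_edge[OF uv] by (rule sum.swap)
  also have "\<dots> = (\<Sum>j<b. 2 * mpow n (b - 1) u v X)"
    using * by (intro sum.cong refl) (simp add: sum.distrib)
  finally show ?thesis by simp
qed

definition trs :: "nat \<Rightarrow> nat multiset \<Rightarrow> (nat set \<Rightarrow> real) \<Rightarrow> real" where
  "trs n A X = (\<Prod>a\<in>#A. tr n a X)"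

definition dtrs :: "nat \<Rightarrow> nat multiset \<Rightarrow> nat set \<Rightarrow> (nat set \<Rightarrow> real) \<Rightarrow> real" where
  "dtrs n A e X = (\<Sum>a\<in>#A. dtr n a e X * trs n (A - {#a#}) X)"

lemma trs_simps [simp]: "trs n {#} X = 1" "trs n (add_mset a A) X = tr n a X * trs n A X"
  by (simp_all add: trs_def)

lemma dtrs_add_mset: "dtrs n (add_mset a A) e X = dtr n a e X * trs n A X + tr n a X * dtrs n A e X"
proof -
  have "(\<Sum>b\<in>#A. dtr n b e X * trs n (add_mset a A - {#b#}) X) =
    (\<Sum>b\<in>#A. tr n a X * (dtr n b e X * trs n (A - {#b#}) X))"
  proof (rule arg_cong[of _ _ sum_mset], rule image_mset_cong)
    fix b assume "b \<in># A"
    then have "add_mset a A - {#b#} = add_mset a (A - {#b#})"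
      by (metis add_mset_commute add_mset_remove_trivial insert_DiffM)
    then show "dtr n b e X * trs n (add_mset a A - {#b#}) X =
      tr n a X * (dtr n b e X * trs n (A - {#b#}) X)" by simp
  qed
  then show ?thesis by (simp add: dtrs_def sum_mset_distrib_left)
qed

lemma nonneg_poly_trs: "nonneg_poly n (sum_mset A) (trs n A) (dtrs n A)"
proof (induction A)
  case empty
  show ?case using nonneg_poly_one[of n 0] by (simp add: trs_def[abs_def] dtrs_def[abs_def])
next
  case (add a A)
  have "nonneg_poly n (a + sum_mset A) (\<lambda>X. tr n a X * trs n A X)
    (\<lambda>e X. dtr n a e X * trs n A X + tr n a X * dtrs n A e X)"
    by (rule nonneg_poly_mult[OF nonneg_poly_tr add.IH])
  then show ?case by (simp flip: trs_simps dtrs_add_mset)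
qed

section \<open>Mixed moments of traces and their loop inequalities\<close>

definition mom :: "nat \<Rightarrow> nat multiset \<Rightarrow> real" where
  "mom n A = expct n (trs n A)"

lemma sum_offdiag_le:
  fixes f :: "nat \<Rightarrow> nat \<Rightarrow> real"
  assumes "\<And>u. u \<in> {1..n} \<Longrightarrow> f u u \<ge> 0"
  shows "(\<Sum>u\<in>{1..n}. \<Sum>v\<in>{1..n}. if u = v then 0 else f u v) \<le> (\<Sum>u\<in>{1..n}. \<Sum>v\<in>{1..n}. f u v)"
  using assms by (intro sum_mono) auto

lemma sum_mset_nonneg:
  fixes f :: "'a \<Rightarrow> real"
  shows "(\<And>x. x \<in># A \<Longrightarrow> f x \<ge> 0) \<Longrightarrow> (\<Sum>x\<in>#A. f x) \<ge> 0"
  by (induction A) (auto intro!: add_nonneg_nonneg)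

text \<open>A Schwinger-Dyson type inequality. One factor of A is split off from the trace of A^(a +
  1), and \<open>expct_edge_mult_le\<close> is applied to it. A derivative falling on the rest of
  this trace splits it in two if the edge is met again in the opposite direction, and leaves a
  single trace of A^(a - 1) if it is met in the same direction. A derivative falling on another
  trace of A^b merges the two.\<close>

lemma loop_inequality:
  "mom n (add_mset (Suc a) A) \<le> (\<Sum>j<a. mom n (add_mset j (add_mset (a - 1 - j) A))) +
     a * mom n (add_mset (a - 1) A) + (\<Sum>b\<in>#A. 2 * b * mom n (add_mset (a + b - 1) (A - {#b#})))"
proof -
  let ?V = "{1..n}"
  let ?S = "\<lambda>f. \<Sum>u\<in>?V. \<Sum>v\<in>?V. f u v :: real"
  let ?F = "\<lambda>u v X. (\<Sum>j<a. mpow n j v v X * mpow n (a - 1 - j) u u X * trs n A X) +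
    ((\<Sum>j<a. mpow n j v u X * mpow n (a - 1 - j) v u X * trs n A X) +
    (\<Sum>b\<in>#A. 2 * b * (mpow n a v u X * mpow n (b - 1) u v X * trs n (A - {#b#}) X)))"
  have nonneg: "expct n (?F u u) \<ge> 0" if "u \<in> ?V" for u
    unfolding expct_add expct_sum expct_sum_mset expct_cmult using that
    by (intro add_nonneg_nonneg sum_nonneg sum_mset_nonneg mult_nonneg_nonneg
        nonneg_poly_expct_nonneg[OF nonneg_poly_mult[OF nonneg_poly_mult[OF nonneg_poly_mpow nonneg_poly_mpow]
          nonneg_poly_trs]]) auto
  have edge: "expct n (\<lambda>X. entry u v X * (mpow n a v u X * trs n A X)) \<le> expct n (?F u v)"
    if uv: "u \<in> ?V" "v \<in> ?V" "u \<noteq> v" for u v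
  proof -
    have "expct n (\<lambda>X. X {u, v} * (mpow n a v u X * trs n A X)) \<le>
      expct n (\<lambda>X. dmpow n a v u {u, v} X * trs n A X + mpow n a v u X * dtrs n A {u, v} X)"
      using uv by (intro expct_edge_mult_le[OF nonneg_poly_mult[OF nonneg_poly_mpow nonneg_poly_trs]]
          edge_in_potential_edges)
    also have "\<dots> = expct n (?F u v)"
    proof (rule expct_cong)
      fix X
      have "mpow n a v u X * dtrs n A {u, v} X =
        (\<Sum>b\<in>#A. 2 * b * (mpow n a v u X * mpow n (b - 1) u v X * trs n (A - {#b#}) X))"
        unfolding dtrs_def dtr_edge[OF uv] sum_mset_distrib_left
        by (intro arg_cong[of _ _ sum_mset] image_mset_cong) (simp add: mult_ac)
      moreover have "dmpow n a v u {u, v} X * trs n A X =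
        (\<Sum>j<a. mpow n j v v X * mpow n (a - 1 - j) u u X * trs n A X) +
        (\<Sum>j<a. mpow n j v u X * mpow n (a - 1 - j) v u X * trs n A X)"
        unfolding dmpow_edge[OF uv] sum_distrib_right by (simp add: sum.distrib algebra_simps)
      ultimately show "dmpow n a v u {u, v} X * trs n A X + mpow n a v u X * dtrs n A {u, v} X = ?F u v X"
        by (simp only: add.assoc)
    qed
    finally show ?thesis using uv by (simp add: entry_def)
  qed
  have "mom n (add_mset (Suc a) A) =
    expct n (\<lambda>X. ?S (\<lambda>u v. entry u v X * (mpow n a v u X * trs n A X)))"
    unfolding mom_def by (rule expct_cong) (simp add: tr_def sum_distrib_right mult.assoc)
  also have "\<dots> = ?S (\<lambda>u v. expct n (\<lambda>X. entry u v X * (mpow n a v u X * trs n A X)))"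
    by (simp only: expct_sum)
  also have "\<dots> = ?S (\<lambda>u v. if u = v then 0 else
    expct n (\<lambda>X. entry u v X * (mpow n a v u X * trs n A X)))"
    by (intro sum.cong refl) (simp add: entry_def)
  also have "\<dots> \<le> ?S (\<lambda>u v. if u = v then 0 else expct n (?F u v))"
    using edge by (intro sum_mono) auto
  \<comment> \<open>Diagonal pairs are absent on the left; their terms on the right are nonnegative,
    so the sums can be completed to full traces.\<close>
  also have "\<dots> \<le> ?S (\<lambda>u v. expct n (?F u v))"
    using nonneg by (rule sum_offdiag_le)
  also have "\<dots> = expct n (\<lambda>X. ?S (\<lambda>u v. ?F u v X))"
    by (simp only: expct_sum)
  also have "\<dots> = expct n (\<lambda>X. (\<Sum>j<a. trs n (add_mset j (add_mset (a - 1 - j) A)) X) +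
    (a * trs n (add_mset (a - 1) A) X +
    (\<Sum>b\<in>#A. 2 * b * trs n (add_mset (a + b - 1) (A - {#b#})) X)))"
  proof (rule expct_cong)
    fix X
    have 1: "?S (\<lambda>u v. \<Sum>j<a. mpow n j v v X * mpow n (a - 1 - j) u u X * trs n A X) =
      (\<Sum>j<a. trs n (add_mset j (add_mset (a - 1 - j) A)) X)"
    proof -
      have "?S (\<lambda>u v. \<Sum>j<a. mpow n j v v X * mpow n (a - 1 - j) u u X * trs n A X) =
        (\<Sum>j<a. ?S (\<lambda>u v. mpow n j v v X * mpow n (a - 1 - j) u u X * trs n A X))"
        by (simp only: sum.swap[of _ "{..<a}"])
      also have "\<dots> = (\<Sum>j<a. trs n (add_mset j (add_mset (a - 1 - j) A)) X)"
        by (simp add: tr_def sum_distrib_right sum_distrib_left mult_ac)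
      finally show ?thesis .
    qed
    \<comment> \<open>Edge met in the same direction: both powers carry the indices (v, u), and by
      symmetry the double sum is a single trace.\<close>
    have 2: "?S (\<lambda>u v. \<Sum>j<a. mpow n j v u X * mpow n (a - 1 - j) v u X * trs n A X) =
      a * trs n (add_mset (a - 1) A) X"
    proof -
      have "?S (\<lambda>u v. \<Sum>j<a. mpow n j v u X * mpow n (a - 1 - j) v u X * trs n A X) =
        (\<Sum>j<a. ?S (\<lambda>u v. mpow n j v u X * mpow n (a - 1 - j) v u X) * trs n A X)"
        by (simp only: sum.swap[of _ "{..<a}"] sum_distrib_right)
      also have "\<dots> = (\<Sum>j<a. tr n (j + (a - 1 - j)) X * trs n A X)"
        unfolding tr_add' by (subst sum.swap) simp
      also have "\<dots> = a * trs n (add_mset (a - 1) A) X"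
        by simp
      finally show ?thesis .
    qed
    have 3: "?S (\<lambda>u v. \<Sum>b\<in>#A. 2 * b * (mpow n a v u X * mpow n (b - 1) u v X * trs n (A - {#b#}) X)) =
      (\<Sum>b\<in>#A. 2 * b * trs n (add_mset (a + b - 1) (A - {#b#})) X)"
    proof -
      have swap: "?S (\<lambda>u v. \<Sum>b\<in>#B. g b u v) = (\<Sum>b\<in>#B. ?S (g b))" for g and B :: "nat multiset"
        by (induction B) (simp_all add: sum.distrib)
      have "?S (\<lambda>u v. 2 * b * (mpow n a v u X * mpow n (b - 1) u v X * trs n (A - {#b#}) X)) =
          2 * b * trs n (add_mset (a + b - 1) (A - {#b#})) X" for b
      \<comment> \<open>For b > 0 the exponent a + b - 1 equals a + (b - 1); for b = 0 both sides
        vanish.\<close>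
      proof (cases "b = 0")
        case False
        then have "tr n (a + b - 1) X = ?S (\<lambda>v u. mpow n a v u X * mpow n (b - 1) u v X)"
          using tr_add[of n a "b - 1" X] by simp
        also have "\<dots> = ?S (\<lambda>u v. mpow n a v u X * mpow n (b - 1) u v X)"
          by (rule sum.swap)
        finally show ?thesis by (simp add: sum_distrib_right sum_distrib_left)
      qed simp
      then show ?thesis unfolding swap by simp
    qed
    show "?S (\<lambda>u v. ?F u v X) = (\<Sum>j<a. trs n (add_mset j (add_mset (a - 1 - j) A)) X) +
      (a * trs n (add_mset (a - 1) A) X +
      (\<Sum>b\<in>#A. 2 * b * trs n (add_mset (a + b - 1) (A - {#b#})) X))"
      unfolding sum.distrib 1 2 3 ..
  qed
  also have "\<dots> = (\<Sum>j<a. mom n (add_mset j (add_mset (a - 1 - j) A))) +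
     a * mom n (add_mset (a - 1) A) + (\<Sum>b\<in>#A. 2 * b * mom n (add_mset (a + b - 1) (A - {#b#})))"
    unfolding expct_add expct_sum expct_sum_mset expct_cmult mom_def by (simp add: add.assoc del: trs_simps)
  finally show ?thesis .
qed

subsection \<open>The perturbed Catalan recursion\<close>

text \<open>For \<delta> = 0 these are the moments of the semicircle law: Catalan numbers at even
  indices and 0 at odd ones.\<close>

fun psi :: "real \<Rightarrow> real \<Rightarrow> nat \<Rightarrow> real" where
  "psi \<beta> \<delta> 0 = 1"
| "psi \<beta> \<delta> (Suc a) = (\<Sum>j<a. psi \<beta> \<delta> j * psi \<beta> \<delta> (a - 1 - j)) + \<delta> * \<beta> ^ Suc a"

declare psi.simps(2) [simp del]

lemma psi_nonneg:
  assumes "\<beta> > 0" "\<delta> \<ge> 0"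
  shows "psi \<beta> \<delta> a \<ge> 0"
proof (induction a rule: less_induct)
  case (less a)
  show ?case
  proof (cases a)
    case (Suc k)
    then show ?thesis using less assms
      by (auto simp: psi.simps(2) intro!: add_nonneg_nonneg sum_nonneg mult_nonneg_nonneg)
  qed simp
qed

text \<open>Needed when two traces merge in \<open>mom_le\<close>: the factor belonging to the trace
  that disappears has to be bounded from below.\<close>

lemma psi_lower:
  assumes "\<beta> > 0" "\<delta> \<ge> 0" "b > 0"
  shows "\<delta> * \<beta> ^ b \<le> psi \<beta> \<delta> b"
  using assms psi_nonneg[OF assms(1,2)]
  by (cases b) (auto simp: psi.simps(2) intro!: sum_nonneg mult_nonneg_nonneg)

text \<open>The pairs (j, a - 1 - j) are distinct for distinct (a, j), so the left side is part of
  the expanded square.\<close>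

lemma sum_convolution_le:
  fixes g :: "nat \<Rightarrow> real"
  assumes "\<And>i. g i \<ge> 0"
  shows "(\<Sum>a\<le>L. \<Sum>j<a. g j * g (a - 1 - j)) \<le> (\<Sum>a\<le>L. g a)\<^sup>2"
proof -
  have "(\<Sum>a\<le>L. \<Sum>j<a. g j * g (a - 1 - j)) = (\<Sum>(a, j)\<in>Sigma {..L} (\<lambda>a. {..<a}). g j * g (a - 1 - j))"
    by (rule sum.Sigma) auto
  also have "\<dots> = (\<Sum>(i, j)\<in>(\<lambda>(a, j). (j, a - 1 - j)) ` Sigma {..L} (\<lambda>a. {..<a}). g i * g j)"
    by (subst sum.reindex) (auto simp: inj_on_def case_prod_unfold)
  also have "\<dots> \<le> (\<Sum>(i, j)\<in>{..L} \<times> {..L}. g i * g j)"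
    using assms by (intro sum_mono2) auto
  also have "\<dots> = (\<Sum>a\<le>L. g a)\<^sup>2"
    by (simp add: power2_eq_square sum_product sum.cartesian_product)
  finally show ?thesis .
qed

text \<open>Each partial sum of \<open>psi \<beta> \<delta> a / \<beta> ^ a\<close> is at most 1 +
  G^2 / \<beta>^2 + \<delta> M, where G is the preceding one. The bound \<beta>^2 / 2 is preserved:
  the quadratic term is then at most \<beta>^2 / 4, and the hypothesis bounds the rest by the same
  amount.\<close>

lemma psi_upper:
  assumes \<beta>: "\<beta> > 0" and \<delta>: "\<delta> \<ge> 0" and M: "1 + \<delta> * M \<le> \<beta>\<^sup>2 / 4" and "a \<le> M"
  shows "psi \<beta> \<delta> a \<le> \<beta>\<^sup>2 / 2 * \<beta> ^ a"
proof -
  define g where "g a = psi \<beta> \<delta> a / \<beta> ^ a" for a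
  have g: "g i \<ge> 0" for i
    using psi_nonneg[OF \<beta> \<delta>] \<beta> by (simp add: g_def)
  have "(\<Sum>a\<le>L. g a) \<le> \<beta>\<^sup>2 / 2" if "L \<le> M" for L
    using that
  proof (induction L)
    case 0
    have "0 \<le> \<delta> * M" using \<delta> by simp
    with M show ?case by (simp add: g_def)
  next
    case (Suc L)
    have step: "g (Suc a) = (\<Sum>j<a. g j * g (a - 1 - j)) / \<beta>\<^sup>2 + \<delta>" for a
    proof -
      have "psi \<beta> \<delta> j * psi \<beta> \<delta> (a - 1 - j) / \<beta> ^ Suc a = g j * g (a - 1 - j) / \<beta>\<^sup>2" if "j < a" for j
      proof -
        have "Suc a = j + (a - 1 - j) + 2" using that by simp
        then have "\<beta> ^ Suc a = \<beta> ^ j * \<beta> ^ (a - 1 - j) * \<beta>\<^sup>2" by (metis power_add)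
        then show ?thesis by (simp add: g_def)
      qed
      then show ?thesis
        using \<beta> by (simp add: g_def[of "Suc a"] psi.simps(2) add_divide_distrib sum_divide_distrib del: power_Suc)
    qed
    have "(\<Sum>a\<le>Suc L. g a) = 1 + ((\<Sum>a\<le>L. \<Sum>j<a. g j * g (a - 1 - j)) / \<beta>\<^sup>2 + \<delta> * Suc L)"
      unfolding sum.atMost_Suc_shift step
      by (simp add: sum.distrib sum_divide_distrib g_def[of 0] del: of_nat_Suc)
    also have "\<dots> \<le> 1 + ((\<beta>\<^sup>2 / 2)\<^sup>2 / \<beta>\<^sup>2 + \<delta> * M)"
    proof -
      have "(\<Sum>a\<le>L. g a)\<^sup>2 \<le> (\<beta>\<^sup>2 / 2)\<^sup>2"
        using Suc g by (intro power_mono sum_nonneg) auto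
      then have "(\<Sum>a\<le>L. \<Sum>j<a. g j * g (a - 1 - j)) \<le> (\<beta>\<^sup>2 / 2)\<^sup>2"
        using sum_convolution_le[of g L, OF g] by linarith
      then show ?thesis
        using \<beta> \<delta> Suc.prems by (intro add_mono divide_right_mono mult_left_mono) auto
    qed
    also have "(\<beta>\<^sup>2 / 2)\<^sup>2 / \<beta>\<^sup>2 = \<beta>\<^sup>2 / 4"
      using \<beta> by (simp add: power2_eq_square)
    finally show ?case using M by linarith
  qed
  from this[OF \<open>a \<le> M\<close>] have "g a \<le> \<beta>\<^sup>2 / 2"
    using member_le_sum[of a "{..a}" g] g by simp
  then show ?thesis using \<beta> by (simp add: g_def pos_divide_le_eq)
qed

subsection \<open>Bounding the moments\<close>

text \<open>The order of magnitude of the trace of A^a: n starting points and a factor sqrt n per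
  step. At a = 0 it equals \<open>tr n 0\<close> exactly.\<close>

definition Phi :: "nat \<Rightarrow> real \<Rightarrow> real \<Rightarrow> nat \<Rightarrow> real" where
  "Phi n \<beta> \<delta> a = n * sqrt n ^ a * psi \<beta> \<delta> a"

text \<open>Induction on the total degree, which \<open>loop_inequality\<close> lowers by 2.
  Splitting terms reproduce the convolution in \<open>psi\<close>; single-trace and merging terms
  are of lower order in n, and each kind is absorbed by half of the perturbation.\<close>

lemma mom_le:
  assumes \<beta>: "\<beta> > 0" and \<delta>: "\<delta> > 0" and M: "1 + \<delta> * M \<le> \<beta>\<^sup>2 / 4" "M \<ge> 2" "M \<le> \<delta> * n"
  shows "sum_mset A \<le> M \<Longrightarrow> mom n A \<le> (\<Prod>a\<in>#A. Phi n \<beta> \<delta> a)"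
proof (induction "sum_mset A" arbitrary: A rule: less_induct)
  case less
  let ?\<phi> = "Phi n \<beta> \<delta>" and ?s = "sqrt (real n)"
  have n: "n > 0" using M \<delta> by (cases n) auto
  then have s: "?s > 0" "?s\<^sup>2 = n" by simp_all
  have \<phi>_nonneg: "?\<phi> a \<ge> 0" for a
    using psi_nonneg[OF \<beta>, of \<delta> a] \<delta> by (simp add: Phi_def)
  show ?case
  proof (cases "\<forall>a\<in>#A. a = 0")
    case True
    have "trs n A = (\<lambda>X. \<Prod>a\<in>#A. ?\<phi> a)"
      unfolding trs_def fun_eq_iff by (intro allI, rule arg_cong[of _ _ prod_mset], rule image_mset_cong)
        (use True in \<open>auto simp: Phi_def\<close>)
    then show ?thesis by (simp add: mom_def)
  next
    case False
    then obtain a B where A: "A = add_mset (Suc a) B"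
      by (metis not0_implies_Suc insert_DiffM)
    let ?P = "\<lambda>B. \<Prod>b\<in>#B. ?\<phi> b"
    \<comment> \<open>Half of the perturbation in \<open>Phi n \<beta> \<delta> (Suc a)\<close>, one
      half for each kind of lower-order term.\<close>
    let ?p = "n * ?s ^ Suc a * \<delta> * \<beta> ^ Suc a / 2"
    have aM: "Suc a + sum_mset B \<le> M" using less.prems A by simp
    have P_nonneg: "?P C \<ge> 0" for C
      by (induction C) (auto intro!: mult_nonneg_nonneg \<phi>_nonneg)
    have "mom n A \<le> (\<Sum>j<a. mom n (add_mset j (add_mset (a - 1 - j) B))) +
        a * mom n (add_mset (a - 1) B) + (\<Sum>b\<in>#B. 2 * b * mom n (add_mset (a + b - 1) (B - {#b#})))"
      unfolding A by (rule loop_inequality)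
    also have "\<dots> \<le> (\<Sum>j<a. ?\<phi> j * ?\<phi> (a - 1 - j)) * ?P B + ?p * ?P B + ?p * ?P B"
    proof (intro add_mono)
      show "(\<Sum>j<a. mom n (add_mset j (add_mset (a - 1 - j) B))) \<le> (\<Sum>j<a. ?\<phi> j * ?\<phi> (a - 1 - j)) * ?P B"
        unfolding sum_distrib_right
      proof (rule sum_mono)
        fix j assume "j \<in> {..<a}"
        then have "mom n (add_mset j (add_mset (a - 1 - j) B)) \<le> ?P (add_mset j (add_mset (a - 1 - j) B))"
          using aM A by (intro less.hyps) auto
        then show "mom n (add_mset j (add_mset (a - 1 - j) B)) \<le> ?\<phi> j * ?\<phi> (a - 1 - j) * ?P B"
          by (simp add: mult.assoc)
      qed
    next
      show "a * mom n (add_mset (a - 1) B) \<le> ?p * ?P B"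
      proof (cases a)
        case 0
        then show ?thesis using P_nonneg[of B] \<delta> \<beta> by simp
      next
        case (Suc k)
        have mom_k: "mom n (add_mset k B) \<le> ?\<phi> k * ?P B"
          using less.hyps[of "add_mset k B"] aM A Suc by simp
        have a_k: "a * ?\<phi> k \<le> ?p"
        proof -
          have "psi \<beta> \<delta> k \<le> \<beta>\<^sup>2 / 2 * \<beta> ^ k"
            using \<beta> \<delta> M aM Suc by (intro psi_upper) auto
          then have "a * ?\<phi> k \<le> a * (n * ?s ^ k * (\<beta>\<^sup>2 / 2 * \<beta> ^ k))"
            unfolding Phi_def by (intro mult_left_mono) auto
          also have "\<dots> = a * (n * ?s ^ k * \<beta> ^ Suc a / 2)"
            using Suc by (simp add: power2_eq_square)
          \<comment> \<open>From \<open>a \<le> M\<close> and \<open>M \<le> \<delta> * n\<close>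
            comes the factor n = (sqrt n)^2 that raises the exponent of sqrt n from k = a - 1 to a +
            1.\<close>
          also have "\<dots> \<le> (\<delta> * n) * (n * ?s ^ k * \<beta> ^ Suc a / 2)"
            using aM M \<beta> by (intro mult_right_mono) auto
          also have "\<dots> = \<delta> * ?s\<^sup>2 * (n * ?s ^ k * \<beta> ^ Suc a / 2)"
            unfolding s(2) ..
          also have "\<dots> = ?p"
            using Suc by (simp add: power2_eq_square)
          finally show ?thesis .
        qed
        have "a * mom n (add_mset (a - 1) B) \<le> a * (?\<phi> k * ?P B)"
          using mom_k Suc by (intro mult_left_mono) auto
        also have "\<dots> = a * ?\<phi> k * ?P B" by simp
        also have "\<dots> \<le> ?p * ?P B"
          using a_k P_nonneg by (rule mult_right_mono)
        finally show ?thesis .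
      qed
    next
      \<comment> \<open>Chosen so that replacing \<open>?\<phi> b\<close> by
        \<open>?\<phi> (a + b - 1)\<close> costs at most this factor for every b > 0:
        \<open>psi_upper\<close> bounds the new factor, \<open>psi_lower\<close> the old one. Since
        it does not depend on b, the sum over B reduces to \<open>sum_mset B\<close>.\<close>
      let ?\<kappa> = "?s ^ Suc a * \<beta> ^ Suc a / (2 * n * \<delta>)"
      have "(\<Sum>b\<in>#B. 2 * b * mom n (add_mset (a + b - 1) (B - {#b#}))) \<le> (\<Sum>b\<in>#B. 2 * b * (?\<kappa> * ?P B))"
      proof (rule sum_mset_mono)
        fix b assume b: "b \<in># B"
        show "2 * b * mom n (add_mset (a + b - 1) (B - {#b#})) \<le> 2 * b * (?\<kappa> * ?P B)"
        proof (cases "b = 0")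
          case False
          have B: "B = add_mset b (B - {#b#})" using b by simp
          have sumB: "sum_mset B = b + sum_mset (B - {#b#})" by (subst B) simp
          have "mom n (add_mset (a + b - 1) (B - {#b#})) \<le> ?P (add_mset (a + b - 1) (B - {#b#}))"
            using aM A sumB False by (intro less.hyps) auto
          also have "\<dots> = ?\<phi> (a + b - 1) * ?P (B - {#b#})" by simp
          also have "\<dots> \<le> ?\<kappa> * ?\<phi> b * ?P (B - {#b#})"
          proof (rule mult_right_mono)
            obtain c where c: "b = Suc c" using False by (cases b) auto
            have "psi \<beta> \<delta> (a + c) \<le> \<beta>\<^sup>2 / 2 * \<beta> ^ (a + c)"
              using \<beta> \<delta> M aM sumB c by (intro psi_upper) auto
            then have "?\<phi> (a + b - 1) \<le> n * ?s ^ (a + c) * (\<beta>\<^sup>2 / 2 * \<beta> ^ (a + c))"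
              unfolding Phi_def c add_Suc_right diff_Suc_1 by (intro mult_left_mono) auto
            also have "\<dots> = n * ?s ^ (a + c) * ?s\<^sup>2 * (\<beta>\<^sup>2 / 2 * \<beta> ^ (a + c)) / n"
              unfolding s(2) using n by simp
            also have "\<dots> = ?\<kappa> * (n * ?s ^ b * (\<delta> * \<beta> ^ b))"
              using n \<delta> by (simp add: c power_add power2_eq_square field_simps)
            also have "\<dots> \<le> ?\<kappa> * ?\<phi> b"
              unfolding Phi_def using psi_lower[OF \<beta>, of \<delta> b] \<delta> False \<beta> s n
              by (intro mult_left_mono divide_nonneg_nonneg mult_nonneg_nonneg) auto
            finally show "?\<phi> (a + b - 1) \<le> ?\<kappa> * ?\<phi> b" .
          qed (rule P_nonneg)
          also have "\<dots> = ?\<kappa> * ?P B" by (subst (2) B) simp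
          finally show ?thesis by (intro mult_left_mono) auto
        qed simp
      qed
      also have "\<dots> = 2 * sum_mset B * (?\<kappa> * ?P B)"
      proof -
        have "(\<Sum>b\<in>#C. 2 * b * t) = 2 * sum_mset C * t" for C :: "nat multiset" and t :: real
          by (induction C) (simp_all add: algebra_simps)
        then show ?thesis .
      qed
      also have "\<dots> \<le> ?p * ?P B"
      proof -
        \<comment> \<open>The factor 2 is absorbed by \<open>M \<ge> 2\<close>, and
          \<open>?\<kappa>\<close> times (\<delta> n)^2 is exactly \<open>?p\<close>.\<close>
        have "2 * real (sum_mset B) \<le> real M * real M"
          using aM M by (intro mult_mono) (simp_all del: of_nat_sum_mset)
        also have "\<dots> \<le> (\<delta> * n) * (\<delta> * n)"
          using M \<delta> by (intro mult_mono) auto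
        finally have "2 * sum_mset B * ?\<kappa> \<le> (\<delta> * n) * (\<delta> * n) * ?\<kappa>"
          using \<beta> \<delta> s by (intro mult_right_mono) auto
        also have "\<dots> = ?p" using n \<delta> by (simp add: field_simps)
        finally show ?thesis using P_nonneg[of B] by (simp only: mult.assoc[symmetric] mult_right_mono)
      qed
      finally show "(\<Sum>b\<in>#B. 2 * b * mom n (add_mset (a + b - 1) (B - {#b#}))) \<le> ?p * ?P B" .
    qed
    also have "\<dots> = ((\<Sum>j<a. ?\<phi> j * ?\<phi> (a - 1 - j)) + 2 * ?p) * ?P B"
      by (simp add: algebra_simps)
    also have "(\<Sum>j<a. ?\<phi> j * ?\<phi> (a - 1 - j)) + 2 * ?p = ?\<phi> (Suc a)"
    proof -
      have "?\<phi> j * ?\<phi> (a - 1 - j) = n * ?s ^ Suc a * (psi \<beta> \<delta> j * psi \<beta> \<delta> (a - 1 - j))" if "j < a" for j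
      proof -
        have "Suc a = j + (a - 1 - j) + 2" using that by simp
        then have "?s ^ Suc a = ?s ^ j * ?s ^ (a - 1 - j) * ?s\<^sup>2" by (metis power_add)
        then show ?thesis unfolding s(2) by (simp add: Phi_def)
      qed
      then show ?thesis
        by (simp add: Phi_def[of _ _ _ "Suc a"] psi.simps(2) distrib_left sum_distrib_left del: power_Suc)
    qed
    also have "?\<phi> (Suc a) * ?P B = ?P A" by (simp add: A)
    finally show ?thesis .
  qed
qed

text \<open>The case \<open>{#N, N#}\<close> of \<open>mom_le\<close>, of total degree 2 N. As the
  bound there factorizes, the second moment is at most the square of the bound for a single
  trace.\<close>

lemma second_moment_tr_le:
  fixes \<beta> \<delta> :: real
  assumes \<beta>: "\<beta> > 0" and \<delta>: "\<delta> > 0" and N: "1 + \<delta> * (2 * N) \<le> \<beta>\<^sup>2 / 4" "N \<ge> 1" "2 * N \<le> \<delta> * n"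
  shows "expct n (\<lambda>X. (tr n N X)\<^sup>2) \<le> (n * (\<beta>\<^sup>2 / 2) * (\<beta> * sqrt n) ^ N)\<^sup>2"
proof -
  have "expct n (\<lambda>X. (tr n N X)\<^sup>2) = mom n {#N, N#}"
    by (simp add: mom_def power2_eq_square cong: expct_cong)
  also have "\<dots> \<le> (\<Prod>a\<in>#{#N, N#}. Phi n \<beta> \<delta> a)"
    by (rule mom_le[where M = "2 * N"]) (use assms in auto)
  also have "\<dots> = (Phi n \<beta> \<delta> N)\<^sup>2" by (simp add: power2_eq_square)
  also have "\<dots> \<le> (n * (\<beta>\<^sup>2 / 2) * (\<beta> * sqrt n) ^ N)\<^sup>2"
  proof (rule power_mono)
    have "psi \<beta> \<delta> N \<le> \<beta>\<^sup>2 / 2 * \<beta> ^ N"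
      using \<beta> \<delta> N by (intro psi_upper[of _ _ "2 * N"]) auto
    then have "Phi n \<beta> \<delta> N \<le> n * sqrt n ^ N * (\<beta>\<^sup>2 / 2 * \<beta> ^ N)"
      unfolding Phi_def by (intro mult_left_mono) auto
    then show "Phi n \<beta> \<delta> N \<le> n * (\<beta>\<^sup>2 / 2) * (\<beta> * sqrt n) ^ N"
      by (simp add: power_mult_distrib mult_ac)
  qed (use psi_nonneg[OF \<beta>, of \<delta> N] \<delta> in \<open>simp add: Phi_def\<close>)
  finally show ?thesis .
qed

subsection \<open>Evaluating formal polynomials\<close>

definition mev :: "('v \<Rightarrow>\<^sub>0 nat) \<Rightarrow> ('v \<Rightarrow> real) \<Rightarrow> real" where
  "mev m x = (\<Prod>v\<in>Poly_Mapping.keys m. x v ^ Poly_Mapping.lookup m v)"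

lemma mev_superset:
  assumes "finite S" "Poly_Mapping.keys m \<subseteq> S"
  shows "mev m x = (\<Prod>v\<in>S. x v ^ Poly_Mapping.lookup m v)"
  unfolding mev_def using assms by (intro prod.mono_neutral_left) (auto simp: in_keys_iff)

lemma mev_add: "mev (l + m) x = mev l x * mev m x"
proof -
  let ?S = "Poly_Mapping.keys l \<union> Poly_Mapping.keys m"
  have "finite ?S" by simp
  then show ?thesis
    using mev_superset[of ?S "l + m" x] mev_superset[of ?S l x] mev_superset[of ?S m x]
      Poly_Mapping.keys_add[of l m]
    by (simp add: lookup_add power_add prod.distrib)
qed

lemma mev_single: "mev (Poly_Mapping.single v k) x = x v ^ k"
  using mev_superset[of "{v}" "Poly_Mapping.single v k" x] by (simp add: split: if_splits)

lemma poly_eval_superset: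
  assumes "finite S" "Poly_Mapping.keys p \<subseteq> S"
  shows "poly_eval p x = (\<Sum>m\<in>S. Poly_Mapping.lookup p m * mev m x)"
  unfolding poly_eval_def mev_def using assms by (intro sum.mono_neutral_left) (auto simp: in_keys_iff)

lemma poly_eval_add: "poly_eval (p + r) x = poly_eval p x + poly_eval r x"
proof -
  let ?S = "Poly_Mapping.keys p \<union> Poly_Mapping.keys r"
  have "finite ?S" by simp
  then show ?thesis
    using poly_eval_superset[of ?S "p + r" x] poly_eval_superset[of ?S p x]
      poly_eval_superset[of ?S r x] Poly_Mapping.keys_add[of p r]
    by (simp add: lookup_add distrib_right sum.distrib)
qed

lemma poly_eval_single: "poly_eval (Poly_Mapping.single m c) x = c * mev m x"
  using poly_eval_superset[of "{m}" "Poly_Mapping.single m c" x] by (simp split: if_splits)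

lemma monom_degree_superset:
  assumes "finite S" "Poly_Mapping.keys m \<subseteq> S"
  shows "monom_degree m = (\<Sum>v\<in>S. Poly_Mapping.lookup m v)"
  unfolding monom_degree_def using assms by (intro sum.mono_neutral_left) (auto simp: in_keys_iff)

lemma monom_degree_add: "monom_degree (l + m) = monom_degree l + monom_degree m"
proof -
  let ?S = "Poly_Mapping.keys l \<union> Poly_Mapping.keys m"
  have "finite ?S" by simp
  then show ?thesis
    using monom_degree_superset[of ?S "l + m"] monom_degree_superset[of ?S l]
      monom_degree_superset[of ?S m] Poly_Mapping.keys_add[of l m]
    by (simp add: lookup_add sum.distrib)
qed

lemma ex_monomial:
  "\<exists>k. Poly_Mapping.keys k \<subseteq> set m \<and> monom_degree k = length m \<and> (\<forall>X. mev k X = mon m X)"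
proof (induction m)
  case Nil
  show ?case by (rule exI[of _ 0]) (simp add: monom_degree_def mev_def)
next
  case (Cons e m)
  then obtain k where k: "Poly_Mapping.keys k \<subseteq> set m" "monom_degree k = length m"
    "\<forall>X. mev k X = mon m X" by blast
  have "Poly_Mapping.keys (Poly_Mapping.single e 1 + k) \<subseteq> set (e # m)"
    using Poly_Mapping.keys_add[of "Poly_Mapping.single e 1" k] k(1) by auto
  then show ?case
    using k(2,3)
    by (intro exI[of _ "Poly_Mapping.single e 1 + k"])
      (simp add: monom_degree_add mev_add mev_single, simp add: monom_degree_def)
qed

text \<open>Different words may give the same monomial and their coefficients then add up, so only
  an inclusion of supports is tracked.\<close>

lemma ex_mpoly_monomials:
  assumes "\<And>m. m \<in> set ms \<Longrightarrow> set m \<subseteq> E" "\<And>m. m \<in> set ms \<Longrightarrow> length m \<le> d"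
  shows "\<exists>p. poly_vars p \<subseteq> E \<and> total_degree p \<le> d \<and> (\<forall>X. poly_eval p X = c * (\<Sum>m\<leftarrow>ms. mon m X))"
proof -
  have "\<exists>p. (\<forall>k\<in>Poly_Mapping.keys p. Poly_Mapping.keys k \<subseteq> E \<and> monom_degree k \<le> d) \<and>
    (\<forall>X. poly_eval p X = c * (\<Sum>m\<leftarrow>ms. mon m X))"
    using assms
  proof (induction ms)
    case Nil
    show ?case by (rule exI[of _ 0]) (simp add: poly_eval_def)
  next
    case (Cons m ms)
    from Cons.IH Cons.prems obtain p where
      p: "\<forall>k\<in>Poly_Mapping.keys p. Poly_Mapping.keys k \<subseteq> E \<and> monom_degree k \<le> d"
      "\<forall>X. poly_eval p X = c * (\<Sum>m\<leftarrow>ms. mon m X)" by auto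
    from ex_monomial obtain k where k: "Poly_Mapping.keys k \<subseteq> set m" "monom_degree k = length m"
      "\<forall>X. mev k X = mon m X" by blast
    let ?p = "Poly_Mapping.single k c + p"
    have "Poly_Mapping.keys ?p \<subseteq> insert k (Poly_Mapping.keys p)"
      using Poly_Mapping.keys_add[of "Poly_Mapping.single k c" p] by (auto split: if_splits)
    moreover have "Poly_Mapping.keys k \<subseteq> E \<and> monom_degree k \<le> d"
      using Cons.prems[of m] k by auto
    ultimately have "\<forall>l\<in>Poly_Mapping.keys ?p. Poly_Mapping.keys l \<subseteq> E \<and> monom_degree l \<le> d"
      using p(1) by blast
    then show ?case
      using p(2) k(3)
      by (intro exI[of _ ?p]) (simp add: poly_eval_add poly_eval_single distrib_left)
  qed
  then show ?thesis
    unfolding poly_vars_def total_degree_def by (fastforce simp: UN_subset_iff)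
qed

lemma nonneg_poly_ex_mpoly:
  assumes "nonneg_poly n d F D"
  shows "\<exists>p. poly_vars p \<subseteq> potential_edges n \<and> total_degree p \<le> d \<and> (\<forall>X. poly_eval p X = c * F X)"
  using assms by (rule nonneg_polyE) (simp add: ex_mpoly_monomials)

subsection \<open>Colorable graphs have large traces\<close>

text \<open>The quadratic form of A^k at the indicator vector of S.\<close>

definition qform :: "nat \<Rightarrow> nat set \<Rightarrow> nat \<Rightarrow> (nat set \<Rightarrow> real) \<Rightarrow> real" where
  "qform n S k X = (\<Sum>x\<in>S. \<Sum>y\<in>S. mpow n k x y X)"

lemma sum_squared_le:
  fixes f :: "'a \<Rightarrow> real"
  shows "(\<Sum>x\<in>S. f x)\<^sup>2 \<le> card S * (\<Sum>x\<in>S. (f x)\<^sup>2)"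
  using Cauchy_Schwarz_ineq_sum[of "\<lambda>_. 1" f S] by simp

text \<open>By symmetry of A, the form of A^(2k) is the squared norm of A^k applied to the indicator
  of S.\<close>

lemma qform_double:
  assumes "S \<subseteq> {1..n}"
  shows "qform n S (k + k) X = (\<Sum>z\<in>{1..n}. (\<Sum>x\<in>S. mpow n k x z X)\<^sup>2)"
proof -
  have "qform n S (k + k) X = (\<Sum>x\<in>S. \<Sum>y\<in>S. \<Sum>z\<in>{1..n}. mpow n k x z X * mpow n k y z X)"
    unfolding qform_def
  proof (intro sum.cong refl)
    fix x y assume "x \<in> S" "y \<in> S"
    then have "x \<in> {1..n}" "y \<in> {1..n}" using assms by auto
    then show "mpow n (k + k) x y X = (\<Sum>z\<in>{1..n}. mpow n k x z X * mpow n k y z X)"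
      unfolding mpow_add[OF \<open>x \<in> {1..n}\<close>]
      by (intro sum.cong refl arg_cong2[where f="(*)"] mpow_sym)
  qed
  also have "\<dots> = (\<Sum>z\<in>{1..n}. \<Sum>x\<in>S. \<Sum>y\<in>S. mpow n k x z X * mpow n k y z X)"
    by (simp only: sum.swap[of _ "{1..n}" S])
  also have "\<dots> = (\<Sum>z\<in>{1..n}. (\<Sum>x\<in>S. mpow n k x z X)\<^sup>2)"
    by (simp add: power2_eq_square sum_product)
  finally show ?thesis .
qed

text \<open>Cauchy-Schwarz between the indicator of S and A^k applied to it.\<close>

lemma qform_square_le:
  assumes S: "S \<subseteq> {1..n}"
  shows "(qform n S k X)\<^sup>2 \<le> card S * qform n S (k + k) X"
proof -
  have "qform n S k X = (\<Sum>z\<in>S. \<Sum>x\<in>S. mpow n k x z X)"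
    unfolding qform_def by (rule sum.swap)
  then have "(qform n S k X)\<^sup>2 \<le> card S * (\<Sum>z\<in>S. (\<Sum>x\<in>S. mpow n k x z X)\<^sup>2)"
    using sum_squared_le by simp
  also have "\<dots> \<le> card S * qform n S (k + k) X"
    unfolding qform_double[OF S] using S by (intro mult_left_mono sum_mono2) auto
  finally show ?thesis .
qed

text \<open>Cauchy-Schwarz in each coordinate bounds the squared norm by \<open>card S\<close> times
  the squared Frobenius norm of A^k, which is the trace of A^(2k).\<close>

lemma qform_le_tr:
  assumes S: "S \<subseteq> {1..n}"
  shows "qform n S (k + k) X \<le> card S * tr n (k + k) X"
proof -
  have "qform n S (k + k) X \<le> (\<Sum>z\<in>{1..n}. card S * (\<Sum>x\<in>{1..n}. (mpow n k x z X)\<^sup>2))"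
    unfolding qform_double[OF S]
  proof (rule sum_mono)
    fix z
    have "(\<Sum>x\<in>S. mpow n k x z X)\<^sup>2 \<le> card S * (\<Sum>x\<in>S. (mpow n k x z X)\<^sup>2)"
      by (rule sum_squared_le)
    also have "\<dots> \<le> card S * (\<Sum>x\<in>{1..n}. (mpow n k x z X)\<^sup>2)"
      using S by (intro mult_left_mono sum_mono2) auto
    finally show "(\<Sum>x\<in>S. mpow n k x z X)\<^sup>2 \<le> card S * (\<Sum>x\<in>{1..n}. (mpow n k x z X)\<^sup>2)" .
  qed
  also have "\<dots> = card S * (\<Sum>z\<in>{1..n}. \<Sum>x\<in>{1..n}. (mpow n k x z X)\<^sup>2)"
    by (simp add: sum_distrib_left)
  also have "\<dots> = card S * tr n (k + k) X"
    unfolding tr_add' power2_eq_square by (subst sum.swap) simp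
  finally show ?thesis .
qed

text \<open>By \<open>qform_square_le\<close>, the Rayleigh quotient of A^(2k) is at least the
  square of that of A^k. Iterating this doubles the exponent, which is why it is a power of
  two.\<close>

lemma tr_ge_rayleigh:
  assumes S: "S \<subseteq> {1..n}" "S \<noteq> {}"
  shows "(qform n S 1 X / card S) ^ (2 ^ Suc s) \<le> tr n (2 ^ Suc s) X"
proof -
  have cS: "card S > 0" using S finite_subset[OF S(1)] by (simp add: card_gt_0_iff)
  have sq: "(qform n S k X / card S)\<^sup>2 \<le> qform n S (k + k) X / card S" for k
    using qform_square_le[OF S(1), of k X] cS
    by (simp add: power_divide divide_simps power2_eq_square mult.commute)
  have "(qform n S 1 X / card S) ^ (2 ^ Suc s) \<le> qform n S (2 ^ Suc s) X / card S"
  proof (induction s)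
    case 0
    show ?case using sq[of 1] by (simp add: numeral_2_eq_2)
  next
    case (Suc s)
    have "(qform n S 1 X / card S) ^ (2 ^ Suc (Suc s)) = ((qform n S 1 X / card S) ^ (2 ^ Suc s))\<^sup>2"
      by (metis power_Suc2 power_mult)
    \<comment> \<open>Squaring is monotone here because the left side is an even power; the Rayleigh
      quotient of A itself may be negative.\<close>
    also have "\<dots> \<le> (qform n S (2 ^ Suc s) X / card S)\<^sup>2"
      using Suc.IH by (rule power_mono) (simp add: zero_le_even_power)
    also have "\<dots> \<le> qform n S (2 ^ Suc (Suc s)) X / card S"
      using sq[of "2 ^ Suc s"] by (simp add: mult_2)
    finally show ?case .
  qed
  also have "\<dots> \<le> tr n (2 ^ Suc s) X"
    using qform_le_tr[OF S(1), of "2 ^ s" X] cS by (simp add: divide_simps mult_2 mult.commute)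
  finally show ?thesis .
qed

text \<open>Averaging over the q color classes; the product form avoids dividing n by q.\<close>

lemma large_color_class:
  assumes c: "c \<in> {1..n} \<rightarrow> {1..q}" and n: "n > 0"
  shows "\<exists>k. n \<le> q * card {v \<in> {1..n}. c v = k}"
proof (rule ccontr)
  assume "\<not> ?thesis"
  then have *: "q * card {v \<in> {1..n}. c v = k} < n" for k by (simp add: not_le)
  have "c 1 \<in> {1..q}" using c n by auto
  then have q: "q > 0" by auto
  have "(\<Sum>k\<in>{1..q}. card {v \<in> {1..n}. c v = k}) = n"
    using sum.group[of "{1..n}" "{1..q}" c "\<lambda>_. 1::nat"] c by auto
  then have "q * n = (\<Sum>k\<in>{1..q}. q * card {v \<in> {1..n}. c v = k})"
    by (simp only: sum_distrib_left[symmetric])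
  also have "\<dots> < (\<Sum>k\<in>{1..q}. n)"
    using * q by (intro sum_strict_mono) auto
  finally show False by simp
qed

text \<open>The shift by 1 in the hypothesis on \<rho> compensates the zero diagonal of A: a color
  class S has Rayleigh quotient 1 - \<open>card S\<close>, not -\<open>card S\<close>.\<close>

lemma tr_ge_of_colorable:
  assumes X: "X \<in> colorable_graphs q n" and n: "n > 0" and \<rho>: "\<rho> \<ge> 0" "(\<rho> + 1) * q \<le> n"
  shows "\<rho> ^ (2 ^ Suc s) \<le> tr n (2 ^ Suc s) X"
proof -
  from X obtain c where Xg: "X \<in> graphs n" and c: "c \<in> {1..n} \<rightarrow> {1..q}"
    and proper: "\<And>u v. u \<in> {1..n} \<Longrightarrow> v \<in> {1..n} \<Longrightarrow> u \<noteq> v \<Longrightarrow> X {u, v} = 1 \<Longrightarrow> c u \<noteq> c v"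
    unfolding colorable_graphs_def by blast
  obtain k where k: "n \<le> q * card {v \<in> {1..n}. c v = k}"
    using large_color_class[OF c n] by blast
  define S where "S = {v \<in> {1..n}. c v = k}"
  have nS: "n \<le> q * card S" using k by (simp add: S_def)
  then have q: "q > 0" and "card S > 0"
    using n by (auto intro!: Nat.gr0I)
  have S: "S \<subseteq> {1..n}" "S \<noteq> {}" "finite S" "card S > 0"
    using \<open>card S > 0\<close> by (simp add: S_def, auto simp: card_gt_0_iff)
  have entry: "entry x y X = (if x = y then 0 else -1)" if "x \<in> S" "y \<in> S" for x y
  proof (cases "x = y")
    case False
    have xy: "x \<in> {1..n}" "y \<in> {1..n}" "c x = c y" using that by (auto simp: S_def)
    have "X {x, y} \<in> {-1, 1}"
      using Xg edge_in_potential_edges[OF xy(1,2) False] unfolding graphs_def by blast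
    then show ?thesis using proper[OF xy(1,2) False] xy(3) False by (auto simp: entry_def)
  qed (simp add: entry_def)
  have "qform n S 1 X = (\<Sum>x\<in>S. \<Sum>y\<in>S. if x = y then 0 else -1)"
    unfolding qform_def
  proof (intro sum.cong refl)
    fix x y assume xy: "x \<in> S" "y \<in> S"
    then have "y \<in> {1..n}" using S by blast
    then show "mpow n 1 x y X = (if x = y then 0 else -1)"
      using entry[OF xy] by (simp only: mpow_one)
  qed
  also have "\<dots> = (\<Sum>x\<in>S. \<Sum>y\<in>S. of_bool (x = y) - 1)"
    by (intro sum.cong) auto
  also have "\<dots> = card S * (1 - real (card S))"
    using S(3) by (simp add: sum_subtractf of_bool_def)
  finally have qf: "qform n S 1 X / card S = - (real (card S) - 1)"
    using S(4) by simp
  have "(\<rho> + 1) * q \<le> real (card S) * q"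
    using \<rho>(2) nS by (metis mult.commute of_nat_le_iff of_nat_mult order_trans)
  then have "\<rho> \<le> real (card S) - 1" using q by simp
  then have "\<rho> ^ (2 ^ Suc s) \<le> (real (card S) - 1) ^ (2 ^ Suc s)"
    using \<rho>(1) by (rule power_mono)
  \<comment> \<open>The exponent is even, so the negative sign of the Rayleigh quotient
    disappears.\<close>
  also have "\<dots> = (qform n S 1 X / card S) ^ (2 ^ Suc s)"
    unfolding qf by (rule power_minus_even[symmetric]) simp
  also have "\<dots> \<le> tr n (2 ^ Suc s) X"
    by (rule tr_ge_rayleigh[OF S(1,2)])
  finally show ?thesis .
qed

subsection \<open>The separating polynomial\<close>

lemma ex_power_two_between:
  assumes "1 < (y::real)"
  shows "\<exists>s. y \<le> 2 ^ Suc s \<and> 2 ^ Suc s \<le> 2 * y"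
proof -
  obtain m where "y < 2 ^ m" using real_arch_pow[of 2 y] by auto
  define k where "k = (LEAST m. y \<le> 2 ^ m)"
  have k: "y \<le> 2 ^ k"
    unfolding k_def using less_imp_le[OF \<open>y < 2 ^ m\<close>] by (rule LeastI)
  \<comment> \<open>k = 0 would give \<open>y \<le> 1\<close>.\<close>
  then obtain s where s: "k = Suc s" using assms by (cases k) auto
  have "\<not> y \<le> 2 ^ s" using not_less_Least[of s "\<lambda>m. y \<le> 2 ^ m"] s by (simp add: k_def)
  then show ?thesis using k s by (intro exI[of _ s]) simp
qed

text \<open>K is chosen so that \<open>N \<ge> K * ln n\<close> gives (\<gamma> / \<beta>)^N \<ge>
  n^2, which beats the factor n in \<open>second_moment_tr_le\<close>. The third condition on n
  makes room for \<delta>; the fourth is the one in \<open>tr_ge_of_colorable\<close> with \<rho> =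
  \<gamma> sqrt n.\<close>

lemma ex_separating_polynomial:
  fixes \<beta> \<gamma> K :: real
  assumes \<beta>: "2 < \<beta>" "\<beta> < \<gamma>" and K: "K = 2 / ln (\<gamma> / \<beta>)"
    and n: "n > 0" "1 < K * ln n" "(4 * (K * ln n))\<^sup>2 \<le> (\<beta>\<^sup>2 / 4 - 1) * n"
      "(\<gamma> * sqrt n + 1) * q \<le> n"
  shows "\<exists>p. poly_vars p \<subseteq> potential_edges n \<and> total_degree p \<le> 2 * K * ln n \<and>
    (\<forall>X\<in>colorable_graphs q n. poly_eval p X \<ge> 1) \<and>
    expct n (\<lambda>X. (poly_eval p X)\<^sup>2) \<le> (\<beta>\<^sup>2 / 2 / n)\<^sup>2"
proof -
  obtain s where s: "K * ln n \<le> 2 ^ Suc s" "2 ^ Suc s \<le> 2 * (K * ln n)"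
    using ex_power_two_between[OF n(2)] by blast
  define N :: nat where "N = 2 ^ Suc s"
  have N: "K * ln n \<le> N" "N \<le> 2 * (K * ln n)" "N \<ge> 1" using s by (simp_all add: N_def)
  define R where "R = \<beta>\<^sup>2 / 4 - 1"
  have "2\<^sup>2 < \<beta>\<^sup>2" using \<beta> by (intro power_strict_mono) auto
  then have R: "R > 0" by (simp add: R_def)
  define c where "c = 1 / (\<gamma> * sqrt n) ^ N"
  have c: "c > 0" using \<beta> n by (simp add: c_def)
  obtain p where p: "poly_vars p \<subseteq> potential_edges n" "total_degree p \<le> N"
    "\<And>X. poly_eval p X = c * tr n N X"
    using nonneg_poly_ex_mpoly[OF nonneg_poly_tr[of n N]] by blast
  have "1 \<le> poly_eval p X" if X: "X \<in> colorable_graphs q n" for X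
  proof -
    have "(\<gamma> * sqrt n) ^ N \<le> tr n N X"
      unfolding N_def using \<beta> by (intro tr_ge_of_colorable[OF X n(1) _ n(4)]) auto
    then show ?thesis using \<beta> n(1) by (simp add: p(3) c_def pos_le_divide_eq)
  qed
  moreover have "expct n (\<lambda>X. (poly_eval p X)\<^sup>2) \<le> (\<beta>\<^sup>2 / 2 / n)\<^sup>2"
  proof -
    \<comment> \<open>With \<delta> = R / (2 N) the first condition of
      \<open>second_moment_tr_le\<close> holds with equality; this is its last condition.\<close>
    have *: "2 * N \<le> R / (2 * N) * n"
    proof -
      have "(2 * real N)\<^sup>2 \<le> (4 * (K * ln n))\<^sup>2" using N by (intro power_mono) auto
      also have "\<dots> \<le> R * n" using n(3) by (simp add: R_def)
      finally show ?thesis using N(3) by (simp add: field_simps power2_eq_square)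
    qed
    have "expct n (\<lambda>X. (tr n N X)\<^sup>2) \<le> (n * (\<beta>\<^sup>2 / 2) * (\<beta> * sqrt n) ^ N)\<^sup>2"
      using * \<beta> R N(3)
      by (intro second_moment_tr_le[where \<delta> = "R / (2 * N)"]) (auto simp: R_def)
    then have "c\<^sup>2 * expct n (\<lambda>X. (tr n N X)\<^sup>2) \<le> c\<^sup>2 * (n * (\<beta>\<^sup>2 / 2) * (\<beta> * sqrt n) ^ N)\<^sup>2"
      by (rule mult_left_mono) simp
    moreover have "expct n (\<lambda>X. (poly_eval p X)\<^sup>2) = c\<^sup>2 * expct n (\<lambda>X. (tr n N X)\<^sup>2)"
      by (simp add: p(3) power_mult_distrib expct_cmult)
    ultimately have "expct n (\<lambda>X. (poly_eval p X)\<^sup>2) \<le> (c * (n * (\<beta>\<^sup>2 / 2) * (\<beta> * sqrt n) ^ N))\<^sup>2"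
      by (simp only: power_mult_distrib[of c])
    also have "c * (n * (\<beta>\<^sup>2 / 2) * (\<beta> * sqrt n) ^ N) = n * (\<beta>\<^sup>2 / 2) / (\<gamma> / \<beta>) ^ N"
      using \<beta> n(1) by (simp add: c_def power_mult_distrib power_divide)
    also have "(n * (\<beta>\<^sup>2 / 2) / (\<gamma> / \<beta>) ^ N)\<^sup>2 \<le> (n * (\<beta>\<^sup>2 / 2) / (real n)\<^sup>2)\<^sup>2"
    proof -
      have r: "ln (\<gamma> / \<beta>) > 0" using \<beta> by simp
      have "2 * ln n = K * ln n * ln (\<gamma> / \<beta>)" using r K by simp
      also have "\<dots> \<le> N * ln (\<gamma> / \<beta>)" using N(1) r by (intro mult_right_mono) auto
      finally have "exp (2 * ln n) \<le> exp (N * ln (\<gamma> / \<beta>))" by simp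
      then have "(real n)\<^sup>2 \<le> (\<gamma> / \<beta>) ^ N"
        using n(1) \<beta> by (simp add: exp_of_nat_mult exp_double)
      then show ?thesis
        using n(1) \<beta> by (intro power_mono divide_left_mono mult_pos_pos) auto
    qed
    also have "n * (\<beta>\<^sup>2 / 2) / (real n)\<^sup>2 = \<beta>\<^sup>2 / 2 / n" by (simp add: power2_eq_square)
    finally show ?thesis .
  qed
  moreover have "total_degree p \<le> 2 * K * ln n" using p(2) N(2) by simp
  ultimately show ?thesis using p(1) by blast
qed

text \<open>Serves at those n where the asymptotic conditions fail. Degree 0 respects the degree
  bound even for n \<le> 1, where \<open>ln n\<close> is 0.\<close>

lemma ex_constant_polynomial:
  "\<exists>p. poly_vars p \<subseteq> potential_edges n \<and> total_degree p = 0 \<and> (\<forall>X. poly_eval p X = 1)"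
  using nonneg_poly_ex_mpoly[OF nonneg_poly_one[of n 0], of 1] by auto

theorem theorem2p17:
  fixes b :: real
  assumes "b < 1/2"
  shows "\<exists>C>0. \<forall>q :: nat \<Rightarrow> nat.
    (\<forall>\<^sub>F n in sequentially. real (q n) \<le> b * sqrt (real n)) \<longrightarrow>
    (\<exists>f :: nat \<Rightarrow> nat set mpoly.
       (\<forall>n. poly_vars (f n) \<subseteq> potential_edges n \<and>
            real (total_degree (f n)) \<le> C * ln (real n)) \<and>
       strongly_separates f erdos_renyi_half (\<lambda>n. colorable_graphs (q n) n))"
proof -
  \<comment> \<open>b may be zero or negative. Raising it to at least 1/4 makes
    \<open>1 / b'\<close> meaningful and keeps \<open>b' < 1/2\<close>, which leaves room for 2 <
    \<beta> < \<gamma> < 1 / b'.\<close>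
  define b' where "b' = max b (1/4)"
  have b': "b \<le> b'" "0 < b'" "2 < 1 / b'"
    using assms by (auto simp: b'_def field_simps)
  obtain \<gamma> where "2 < \<gamma>" and \<gamma>: "\<gamma> < 1 / b'" using dense[OF b'(3)] by blast
  obtain \<beta> where \<beta>: "2 < \<beta>" "\<beta> < \<gamma>" using dense[OF \<open>2 < \<gamma>\<close>] by blast
  \<comment> \<open>Fixed before \<open>q\<close> is introduced, so the constant depends on b
    only.\<close>
  define K where "K = 2 / ln (\<gamma> / \<beta>)"
  have K: "K > 0" using \<beta> by (simp add: K_def)
  show ?thesis
  proof (intro exI[of _ "2 * K"] conjI allI impI)
    fix q :: "nat \<Rightarrow> nat"
    assume q: "\<forall>\<^sub>F n in sequentially. real (q n) \<le> b * sqrt (real n)"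
    define good where "good n \<longleftrightarrow> n > 0 \<and> 1 < K * ln n \<and>
      (4 * (K * ln n))\<^sup>2 \<le> (\<beta>\<^sup>2 / 4 - 1) * n \<and> (\<gamma> * sqrt n + 1) * q n \<le> n" for n :: nat
    have good: "\<forall>\<^sub>F n in sequentially. good n"
    proof -
      have "2\<^sup>2 < \<beta>\<^sup>2" using \<beta> by (intro power_strict_mono) auto
      then have R: "\<beta>\<^sup>2 / 4 - 1 > 0" by simp
      have "\<gamma> * b' < 1" using \<gamma> b' by (simp add: field_simps)
      have 1: "\<forall>\<^sub>F n::nat in sequentially. 1 < K * ln n"
        using K by real_asymp
      have 2: "\<forall>\<^sub>F n::nat in sequentially. (4 * (K * ln n))\<^sup>2 \<le> (\<beta>\<^sup>2 / 4 - 1) * n"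
        using K R by real_asymp
      \<comment> \<open>The linear slack \<open>(1 - \<gamma> * b') * n\<close> eventually dominates
        the term \<open>b' * sqrt n\<close>, which stems from the shift by 1 in
        \<open>\<gamma> * sqrt n + 1\<close>.\<close>
      have "1 - \<gamma> * b' > 0" using \<open>\<gamma> * b' < 1\<close> by simp
      then have 3: "\<forall>\<^sub>F n::nat in sequentially. b' * sqrt n \<le> (1 - \<gamma> * b') * n"
        using b' by real_asymp
      show ?thesis
        using q 1 2 3 eventually_gt_at_top[of 0]
      proof eventually_elim
        case (elim n)
        have "real (q n) \<le> b' * sqrt n"
          using elim(1) b'(1) by (meson mult_right_mono order_trans real_sqrt_ge_zero of_nat_0_le_iff)
        then have "(\<gamma> * sqrt n + 1) * q n \<le> (\<gamma> * sqrt n + 1) * (b' * sqrt n)"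
          using \<beta> by (intro mult_left_mono) auto
        also have "\<dots> = \<gamma> * b' * n + b' * sqrt n"
          by (simp add: algebra_simps)
        also have "\<dots> \<le> n" using elim(4) by (simp add: algebra_simps)
        finally show ?case using elim by (simp add: good_def)
      qed
    qed
    \<comment> \<open>The lower bound on colorable graphs is required at every n, the moment bound
      only eventually; so only the latter is conditional on \<open>good n\<close>.\<close>
    have "\<exists>p. poly_vars p \<subseteq> potential_edges n \<and> total_degree p \<le> 2 * K * ln n \<and>
      (\<forall>X\<in>colorable_graphs (q n) n. poly_eval p X \<ge> 1) \<and>
      (good n \<longrightarrow> expct n (\<lambda>X. (poly_eval p X)\<^sup>2) \<le> (\<beta>\<^sup>2 / 2 / n)\<^sup>2)" for n
    proof (cases "good n")
      case True
      then show ?thesis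
        using ex_separating_polynomial[OF \<beta> K_def, of n "q n"] by (simp add: good_def)
    next
      case False
      have "ln (real n) \<ge> 0" by (cases "n = 0") auto
      then have "0 \<le> 2 * K * ln n" using K by simp
      then show ?thesis using ex_constant_polynomial[of n] False by auto
    qed
    then obtain f :: "nat \<Rightarrow> nat set mpoly" where
      f: "\<And>n. poly_vars (f n) \<subseteq> potential_edges n" "\<And>n. total_degree (f n) \<le> 2 * K * ln n"
        "\<And>n X. X \<in> colorable_graphs (q n) n \<Longrightarrow> poly_eval (f n) X \<ge> 1"
        "\<And>n. good n \<Longrightarrow> expct n (\<lambda>X. (poly_eval (f n) X)\<^sup>2) \<le> (\<beta>\<^sup>2 / 2 / n)\<^sup>2"
      by metis
    have "(\<lambda>n. expct n (\<lambda>X. (poly_eval (f n) X)\<^sup>2)) \<longlonglongrightarrow> 0"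
    proof (rule tendsto_sandwich[of "\<lambda>_. 0"])
      show "\<forall>\<^sub>F n in sequentially. 0 \<le> expct n (\<lambda>X. (poly_eval (f n) X)\<^sup>2)"
        by (simp add: expct_eq sum_nonneg)
      show "\<forall>\<^sub>F n in sequentially. expct n (\<lambda>X. (poly_eval (f n) X)\<^sup>2) \<le> (\<beta>\<^sup>2 / 2 / n)\<^sup>2"
        using good by eventually_elim (rule f(4))
      show "(\<lambda>n::nat. (\<beta>\<^sup>2 / 2 / n)\<^sup>2) \<longlonglongrightarrow> 0"
        using \<beta>(1) by real_asymp
    qed simp
    then have "strongly_separates f erdos_renyi_half (\<lambda>n. colorable_graphs (q n) n)"
      unfolding strongly_separates_def expct_def using f(3) by (auto intro: smalloI_tendsto)
    with f(1,2) show "\<exists>f :: nat \<Rightarrow> nat set mpoly.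
       (\<forall>n. poly_vars (f n) \<subseteq> potential_edges n \<and>
            real (total_degree (f n)) \<le> 2 * K * ln (real n)) \<and>
       strongly_separates f erdos_renyi_half (\<lambda>n. colorable_graphs (q n) n)"
      by blast
  qed (use K in simp)
qed

end
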